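(* Consider the constrained Hastings--Levitov model in the upper half-plane with particles of half-plane capacity $1/(2n)$, with cluster $\mathcal{K}_k$ after $k$ arrivals, and write $\mathcal{K}_{nt}=\mathcal{K}_{\lfloor nt\rfloor}$. Let $\operatorname{Diam}(\mathcal{K}_{nt})=\sup\{|x-y|:x,y\in\mathcal{K}_{nt}\}$. For every $t>0$, $$\frac{\operatorname{Diam}(\mathcal{K}_{nt})}{\sqrt{t\log n}}\longrightarrow 1\quad\text{in probability as } n\to\infty.$$ Furthermore (whenever $nt\ge1$), almost surely, $$\max_{z\in\mathcal{K}_{nt}}\Im(z)\le\sqrt{2t}.$$
   Context: Model. Let $\mathbb{H}=\{z\in\mathbb{C}:\Im(z)>0\}$ and fix an integer $n\ge1$. For $x\in\mathbb{R}$ let $F_x(z)=x+\sqrt{(z-x)^2-1/n}$, the conformal map from $\mathbb{H}$ onto $\mathbb{H}$ minus the vertical slit $[x,x+i/\sqrt n]$, with the branch of the square root such that $F_x(z)-z\to0$ as $z\to\infty$. Given real points $x_1,x_2,\ldots$, set $\Phi_0(z)=z$, $\Phi_k=F_{x_1}\circ F_{x_2}\circ\cdots\circ F_{x_k}$, $\mathcal{K}_k=\overline{\mathbb{H}\setminus\Phi_k(\mathbb{H})}$ (the cluster after $k$ arrivals) and $\Gamma_k=\Phi_k^{-1}$. The map $\Gamma_k$ sends $\mathcal{K}_k$ (in the sense of boundary values) to an interval $[-L_k,R_k]$ of the real line. The attachment locations are random: $x_1=0$ (so $L_1=R_1=1/\sqrt n$) and, for $k\ge1$, conditionally on $x_1,\ldots,x_k$,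 the point $x_{k+1}$ is uniformly distributed on $[-L_k,R_k]$. Concretely, $$R_{k+1}=x_{k+1}+\sqrt{(R_k-x_{k+1})^2+1/n},\qquad L_{k+1}=-x_{k+1}+\sqrt{(L_k+x_{k+1})^2+1/n}.$$ All of these quantities depend on $n$. *)

theory Defs
  imports "HOL-Probability.Probability"
begin

section \<open>Slit maps and clusters\<close>

definition upper_half_plane :: "complex set" where
  "upper_half_plane = {z. 0 < Im z}"

text \<open>
  The map \<open>z \<mapsto> x + sqrt ((z - x)^2 - 1/n)\<close>. The principal root has its cut on the negative axis, which
  \<open>(z - x)^2 - 1/n\<close> crosses as \<open>z\<close> ranges over the upper half-plane; rotating by \<open>\<i>\<close> gives the branch
  with positive imaginary part, which is the one asymptotic to \<open>z\<close>
  (\<open>slit_map_sub_tendsto_0\<close> below).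
\<close>

definition slit_map :: "nat \<Rightarrow> real \<Rightarrow> complex \<Rightarrow> complex" where
  "slit_map n x z = of_real x + \<i> * csqrt (1 / of_nat n - (z - of_real x)\<^sup>2)"

text \<open>Particle positions are indexed from 1; the value of \<open>x\<close> at 0 is never used.\<close>

fun cluster_map :: "nat \<Rightarrow> (nat \<Rightarrow> real) \<Rightarrow> nat \<Rightarrow> complex \<Rightarrow> complex" where
  "cluster_map n x 0 = id"
| "cluster_map n x (Suc k) = cluster_map n x k \<circ> slit_map n (x (Suc k))"

definition cluster :: "nat \<Rightarrow> (nat \<Rightarrow> real) \<Rightarrow> nat \<Rightarrow> complex set" where
  "cluster n x k = closure (upper_half_plane - cluster_map n x k ` upper_half_plane)"

text \<open>
  The interval \<open>{- left_end n x k .. right_end n x k}\<close> is the image of the cluster under the inverse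
  of \<open>cluster_map n x k\<close>. With \<open>x 1 = 0\<close>, the value 0 at \<open>k = 0\<close> gives \<open>1 / sqrt n\<close> at \<open>k = 1\<close>
  for both ends.
\<close>

fun right_end :: "nat \<Rightarrow> (nat \<Rightarrow> real) \<Rightarrow> nat \<Rightarrow> real" where
  "right_end n x 0 = 0"
| "right_end n x (Suc k) = x (Suc k) + sqrt ((right_end n x k - x (Suc k))\<^sup>2 + 1 / real n)"

fun left_end :: "nat \<Rightarrow> (nat \<Rightarrow> real) \<Rightarrow> nat \<Rightarrow> real" where
  "left_end n x 0 = 0"
| "left_end n x (Suc k) = - x (Suc k) + sqrt ((left_end n x k + x (Suc k))\<^sup>2 + 1 / real n)"

lemma ends_1:
  assumes "x 1 = 0"
  shows "right_end n x 1 = 1 / sqrt (real n)" "left_end n x 1 = 1 / sqrt (real n)"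
  using assms by (simp_all add: real_sqrt_divide)

lemma slit_map_square:
  "(slit_map n x z - of_real x)\<^sup>2 = (z - of_real x)\<^sup>2 - 1 / of_nat n"
  by (simp add: slit_map_def power_mult_distrib)

lemma slit_map_radicand:
  assumes "z \<in> upper_half_plane"
  shows "1 / of_nat n - (z - of_real x)\<^sup>2 \<notin> \<real>\<^sub>\<le>\<^sub>0"
proof
  assume A: "1 / of_nat n - (z - of_real x)\<^sup>2 \<in> \<real>\<^sub>\<le>\<^sub>0"
  have n: "(1 / of_nat n :: complex) = of_real (1 / real n)" by simp
  have "Im ((z - of_real x)\<^sup>2) = 0" and le: "1 / real n \<le> Re ((z - of_real x)\<^sup>2)"
    using A unfolding n complex_nonpos_Reals_iff by auto
  then have "Re z = x"
    using assms by (auto simp: upper_half_plane_def Im_power2)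
  then have "Re ((z - of_real x)\<^sup>2) = - (Im z)\<^sup>2" by (simp add: Re_power2)
  moreover have "(Im z)\<^sup>2 > 0" using assms by (simp add: upper_half_plane_def)
  moreover have "1 / real n \<ge> 0" by simp
  ultimately show False using le by linarith
qed

lemma Re_csqrt_gt_0:
  assumes "w \<notin> \<real>\<^sub>\<le>\<^sub>0"
  shows "0 < Re (csqrt w)"
proof (rule ccontr)
  assume "\<not> 0 < Re (csqrt w)"
  then have "Re (csqrt w) = 0" using csqrt_principal[of w] by auto
  then have "(csqrt w)\<^sup>2 \<in> \<real>\<^sub>\<le>\<^sub>0"
    unfolding complex_nonpos_Reals_iff Re_power2 Im_power2 by simp
  with assms show False by simp
qed

lemma slit_map_upper_half_plane:
  assumes "z \<in> upper_half_plane"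
  shows "slit_map n x z \<in> upper_half_plane"
  using Re_csqrt_gt_0[OF slit_map_radicand[OF assms]]
  by (simp add: upper_half_plane_def slit_map_def)

lemma slit_map_holomorphic: "slit_map n x holomorphic_on upper_half_plane"
  unfolding slit_map_def[abs_def]
  by (intro holomorphic_intros) (use slit_map_radicand in auto)

lemma slit_map_sub_bound:
  assumes "z \<in> upper_half_plane"
  shows "norm (slit_map n x z - z) * norm (z - of_real x) \<le> 1 / real n"
proof -
  define a where "a = slit_map n x z - of_real x"
  define b where "b = z - of_real x"
  have sq: "a\<^sup>2 = b\<^sup>2 - 1 / of_nat n"
    unfolding a_def b_def by (rule slit_map_square)
  have ia: "Im a > 0" and ib: "Im b > 0"
    using slit_map_upper_half_plane[OF assms] assms
    by (auto simp: upper_half_plane_def a_def b_def)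
  have n: "(1 / of_nat n :: complex) = of_real (1 / real n)" by simp
  have "Im (a\<^sup>2) = Im (b\<^sup>2)" unfolding sq n by simp
  then have e: "Re a * Im a = Re b * Im b" by (simp add: Im_power2)
  have "Re a = Re b * Im b / Im a" using e ia by (simp add: field_simps)
  then have "Re a * Re b = (Re b)\<^sup>2 * Im b / Im a" by (simp add: power2_eq_square)
  then have r: "Re a * Re b \<ge> 0" using ia ib by simp
  have "(norm b)\<^sup>2 \<le> (norm (a + b))\<^sup>2"
    using r ia ib mult_pos_pos[OF ia ib]
    by (simp add: cmod_power2 power2_sum)
  then have "norm b \<le> norm (a + b)" by (rule power2_le_imp_le) simp
  then have "norm (a - b) * norm b \<le> norm (a - b) * norm (a + b)"
    by (rule mult_left_mono) simp
  also have "\<dots> = norm (a\<^sup>2 - b\<^sup>2)"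
    by (simp add: norm_mult[symmetric] power2_eq_square algebra_simps)
  also have "\<dots> = 1 / real n" unfolding sq by (simp add: norm_divide)
  finally show ?thesis by (simp add: a_def b_def)
qed

lemma slit_map_sub_tendsto_0:
  "((\<lambda>z. slit_map n x z - z) \<longlongrightarrow> 0) (inf at_infinity (principal upper_half_plane))"
proof (rule tendsto_norm_zero_cancel, rule tendsto_sandwich)
  let ?F = "inf at_infinity (principal upper_half_plane)"
  show "\<forall>\<^sub>F z in ?F. 0 \<le> norm (slit_map n x z - z)" by simp
  have "norm (slit_map n x z - z) \<le> norm ((1 / of_nat n) / (z - of_real x))"
    if "z \<in> upper_half_plane" for z
  proof -
    have "0 < norm (z - of_real x)" using that by (auto simp: upper_half_plane_def)
    then have "norm (slit_map n x z - z) \<le> (1 / real n) / norm (z - of_real x)"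
      using slit_map_sub_bound[OF that, of n x] by (subst pos_le_divide_eq)
    then show ?thesis by (simp add: norm_divide norm_mult)
  qed
  then show "\<forall>\<^sub>F z in ?F. norm (slit_map n x z - z) \<le> norm ((1 / of_nat n) / (z - of_real x))"
    by (auto simp: eventually_inf_principal)
  have "filterlim (\<lambda>z::complex. z - of_real x) at_infinity at_infinity"
    using tendsto_add_filterlim_at_infinity'[OF filterlim_ident tendsto_const[of "- of_real x"]] by simp
  then have "((\<lambda>z. (1 / of_nat n) / (z - of_real x)) \<longlongrightarrow> (0::complex)) at_infinity"
    by (intro tendsto_divide_0[OF tendsto_const])
  then show "((\<lambda>z. norm ((1 / of_nat n) / (z - of_real x) :: complex)) \<longlongrightarrow> 0) ?F"
    by (intro tendsto_norm_zero) (rule tendsto_mono[rotated], auto)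
qed simp

lemma ii_csqrt_minus_square:
  assumes "Im v > 0"
  shows "\<i> * csqrt (- (v\<^sup>2)) = v"
proof -
  have "csqrt ((- \<i> * v)\<^sup>2) = - \<i> * v"
    by (rule csqrt_square) (use assms in simp)
  then show ?thesis by (simp add: power_mult_distrib)
qed

lemma slit_map_image:
  assumes "n \<ge> 1"
  shows "slit_map n x ` upper_half_plane =
    upper_half_plane - {Complex x s | s. 0 \<le> s \<and> s \<le> 1 / sqrt (real n)}"
proof (intro equalityI subsetI)
  fix w assume "w \<in> slit_map n x ` upper_half_plane"
  then obtain z where z: "z \<in> upper_half_plane" and w: "w = slit_map n x z" by auto
  have "w \<noteq> Complex x s" if s: "0 \<le> s" "s \<le> 1 / sqrt (real n)" for s
  proof
    assume e: "w = Complex x s"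
    have "(w - of_real x)\<^sup>2 = of_real (- (s\<^sup>2))"
      by (simp add: e complex_eq_iff Re_power2 Im_power2)
    then have "(z - of_real x)\<^sup>2 = of_real (- (s\<^sup>2)) + 1 / of_nat n"
      using slit_map_square[of n x z] w by (simp add: algebra_simps)
    then have "1 / of_nat n - (z - of_real x)\<^sup>2 = of_real (s\<^sup>2)" by simp
    then have "w = of_real x + \<i> * csqrt (of_real (s\<^sup>2))" by (simp add: w slit_map_def)
    have eq: "(z - of_real x)\<^sup>2 = of_real (1 / real n - s\<^sup>2)"
      using \<open>(z - of_real x)\<^sup>2 = of_real (- (s\<^sup>2)) + 1 / of_nat n\<close> by simp
    have "s\<^sup>2 \<le> (1 / sqrt (real n))\<^sup>2" using s by (intro power_mono)
    then have ge: "1 / real n - s\<^sup>2 \<ge> 0" by (simp add: power_divide)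
    have im: "Im ((z - of_real x)\<^sup>2) = 0" and re: "Re ((z - of_real x)\<^sup>2) \<ge> 0"
      unfolding eq using ge by simp_all
    have "Re z = x" using im z by (auto simp: Im_power2 upper_half_plane_def)
    then show False using re z by (simp add: Re_power2 upper_half_plane_def)
  qed
  then show "w \<in> upper_half_plane - {Complex x s | s. 0 \<le> s \<and> s \<le> 1 / sqrt (real n)}"
    using slit_map_upper_half_plane[OF z] w by auto
next
  fix w assume A: "w \<in> upper_half_plane - {Complex x s | s. 0 \<le> s \<and> s \<le> 1 / sqrt (real n)}"
  define v where "v = w - of_real x"
  have iv: "Im v > 0" using A by (simp add: v_def upper_half_plane_def)
  have n: "(1 / of_nat n :: complex) = of_real (1 / real n)" by simp
  have notin: "- (v\<^sup>2) - 1 / of_nat n \<notin> \<real>\<^sub>\<le>\<^sub>0"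
  proof
    assume "- (v\<^sup>2) - 1 / of_nat n \<in> \<real>\<^sub>\<le>\<^sub>0"
    then have "Im (v\<^sup>2) = 0" and re: "Re (v\<^sup>2) \<ge> - (1 / real n)"
      unfolding n complex_nonpos_Reals_iff by auto
    then have rv: "Re v = 0" using iv by (auto simp: Im_power2)
    then have "(Im v)\<^sup>2 \<le> 1 / real n" using re by (simp add: Re_power2)
    then have "Im v \<le> 1 / sqrt (real n)"
      using iv real_le_rsqrt by (fastforce simp: real_sqrt_divide)
    moreover have "w = Complex x (Im v)" using rv by (simp add: v_def complex_eq_iff)
    ultimately show False using A iv by auto
  qed
  define z where "z = of_real x + \<i> * csqrt (- (v\<^sup>2) - 1 / of_nat n)"
  have "z \<in> upper_half_plane"
    using Re_csqrt_gt_0[OF notin] by (simp add: z_def upper_half_plane_def)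
  moreover have "slit_map n x z = w"
    using ii_csqrt_minus_square[OF iv]
    by (simp add: slit_map_def z_def power_mult_distrib) (simp add: v_def)
  ultimately show "w \<in> slit_map n x ` upper_half_plane" by auto
qed


section \<open>The random model\<close>

definition past :: "'a measure \<Rightarrow> (nat \<Rightarrow> 'a \<Rightarrow> real) \<Rightarrow> nat \<Rightarrow> 'a measure" where
  "past M X k = vimage_algebra (space M) (\<lambda>\<omega>. \<lambda>i\<in>{1..k}. X i \<omega>) (PiM {1..k} (\<lambda>_. borel))"

locale constrained_HL = prob_space M for M :: "'a measure" +
  fixes n :: nat and X :: "nat \<Rightarrow> 'a \<Rightarrow> real"
  assumes n_ge_1: "1 \<le> n"
    and X_measurable: "\<And>k. 1 \<le> k \<Longrightarrow> random_variable borel (X k)"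
    and X_1: "\<And>\<omega>. \<omega> \<in> space M \<Longrightarrow> X 1 \<omega> = 0"
    and X_Suc_cond_uniform: "\<And>k A. 1 \<le> k \<Longrightarrow> A \<in> sets borel \<Longrightarrow>
      AE \<omega> in M. real_cond_exp M (past M X k) (indicat_real (X (Suc k) -` A \<inter> space M)) \<omega> =
        measure (uniform_measure lborel
          {- left_end n (\<lambda>j. X j \<omega>) k .. right_end n (\<lambda>j. X j \<omega>) k}) A"

text \<open>
  Convergence in probability to a constant, for variables living on possibly different spaces.
  Measurability is part of the notion, since \<open>measure\<close> is 0 on nonmeasurable sets; it is required
  only eventually, as is all that matters for the limit.
\<close>

definition tendsto_in_probability ::
    "(nat \<Rightarrow> 'a measure) \<Rightarrow> (nat \<Rightarrow> 'a \<Rightarrow> real) \<Rightarrow> real \<Rightarrow> bool" where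
  "tendsto_in_probability M Y c \<longleftrightarrow>
    (\<forall>\<^sub>F n in sequentially. Y n \<in> borel_measurable (M n)) \<and>
    (\<forall>\<epsilon>>0. (\<lambda>n. measure (M n) {\<omega> \<in> space (M n). \<epsilon> < \<bar>Y n \<omega> - c\<bar>}) \<longlonglongrightarrow> 0)"

end

theory Submission
  imports Defs "HOL-Complex_Analysis.Complex_Analysis" "HOL-Real_Asymp.Real_Asymp"
begin

text \<open>
  The diameter of the cluster is compared with the length of the interval \<open>[-L, R]\<close> onto which the
  cluster is unfolded, and that length is a Markov chain.

  Slit maps move real parts towards \<open>x\<close> and raise \<open>(Im z)^2\<close> by at most \<open>1/n\<close>. So the cluster lies above
  \<open>[-L, R]\<close> and has height at most \<open>sqrt (k/n)\<close>. Conversely, if the cluster lies in \<open>Re z \<le> b\<close>, the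
  inverse map \<open>\<Gamma>\<close> continues analytically, by reflection, to \<open>Re z > b\<close>. There the imaginary part of
  \<open>g(z) = \<Gamma>(z) - z\<close> is bounded by \<open>s = sqrt (k/n)\<close>, so Cauchy's estimate for \<open>exp (\<i> g / s)\<close> bounds
  \<open>g'\<close> at distance \<open>2 s\<close> from the line \<open>Re z = b\<close>. As \<open>g\<close> is small at height \<open>2 s\<close>, it is \<open>O(s)\<close> on
  the real axis too, which gives \<open>R \<le> b + O(s)\<close>; the left end is symmetric. Hence the diameter is
  \<open>L + R + O(sqrt (k/n))\<close>.

  The rescaled length \<open>W = sqrt n (L + R)\<close> follows a chain that does not depend on \<open>n\<close>:
  \<open>W' = sqrt (w^2 + 1) + sqrt ((W - w)^2 + 1)\<close> with \<open>w\<close> uniform on \<open>[0, W]\<close>. The expected increment of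
  \<open>W^2\<close> is \<open>2 ln (2 W + 1) + O(1)\<close>, and almost surely \<open>2 sqrt k \<le> W \<le> 2 k\<close>. The lower bound makes
  \<open>W^2 - (k ln k - k)\<close> a submartingale with small quadratic variation; the upper bound, improved once
  by Jensen's inequality, gives \<open>E W^2 \<le> k ln k + O(k ln ln k)\<close>. Together they show that
  \<open>W^2 / (k ln k)\<close> tends to 1 in \<open>L^1\<close>, where \<open>k\<close> is about \<open>n t\<close>.
\<close>

section \<open>Geometry of the slit maps and the cluster\<close>

text \<open>Let \<open>a\<close> and \<open>b\<close> be the value and the argument relative to
  \<open>x\<close>, so \<open>a\<^sup>2 = b\<^sup>2 - 1/n\<close>. The imaginary part gives the
  product identity, the real part a difference of squares. If \<open>Im\<close> decreased, the
  latter would make \<open>|Re|\<close> decrease too, against the product identity. So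
  \<open>Im\<close> cannot decrease, \<open>|Re|\<close> cannot increase, and
  \<open>(Im)\<^sup>2\<close> gains at most \<open>1/n\<close>.\<close>

lemma slit_map_geometry:
  assumes "Im z > 0"
  shows Im_slit_map_pos: "Im (slit_map n x z) > 0"
    and Re_slit_map: "(Re (slit_map n x z) - x) * Im (slit_map n x z) = (Re z - x) * Im z"
    and Im_slit_map_ge: "Im z \<le> Im (slit_map n x z)"
    and Im_slit_map_le: "(Im (slit_map n x z))\<^sup>2 \<le> (Im z)\<^sup>2 + 1 / real n"
proof -
  define a where "a = slit_map n x z - of_real x"
  define b where "b = z - of_real x"
  have n: "(1 / of_nat n :: complex) = of_real (1 / real n)" by simp
  have sq: "a\<^sup>2 = b\<^sup>2 - 1 / of_nat n"
    unfolding a_def b_def by (rule slit_map_square)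
  have ia: "Im a > 0" and ib: "Im b > 0"
    using slit_map_upper_half_plane[of z n x] assms
    by (auto simp: upper_half_plane_def a_def b_def)
  have "Im (a\<^sup>2) = Im (b\<^sup>2)" unfolding sq n by simp
  then have e: "Re a * Im a = Re b * Im b" by (simp add: Im_power2)
  have "Re (a\<^sup>2) = Re (b\<^sup>2) - 1 / real n" unfolding sq n by simp
  then have r: "(Re a)\<^sup>2 - (Im a)\<^sup>2 = (Re b)\<^sup>2 - (Im b)\<^sup>2 - 1 / real n" by (simp add: Re_power2)
  have c: "1 / real n \<ge> 0" by simp
  show "Im (slit_map n x z) > 0" using ia by (simp add: a_def)
  show "(Re (slit_map n x z) - x) * Im (slit_map n x z) = (Re z - x) * Im z"
    using e by (simp add: a_def b_def)
  have e2: "(Re a)\<^sup>2 * (Im a)\<^sup>2 = (Re b)\<^sup>2 * (Im b)\<^sup>2"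
    using e by (metis power_mult_distrib)
  have ge: "Im b \<le> Im a"
  proof (rule ccontr)
    assume "\<not> Im b \<le> Im a"
    then have lt: "Im a < Im b" by simp
    then have l2: "(Im a)\<^sup>2 < (Im b)\<^sup>2" using ia by (intro power_strict_mono) auto
    then have "(Re a)\<^sup>2 < (Re b)\<^sup>2" using r c by linarith
    then have "(Re a)\<^sup>2 * (Im a)\<^sup>2 < (Re b)\<^sup>2 * (Im b)\<^sup>2"
      using l2 by (intro mult_strict_mono) auto
    then show False using e2 by simp
  qed
  then show "Im z \<le> Im (slit_map n x z)" by (simp add: a_def b_def)
  have ge2: "(Im b)\<^sup>2 \<le> (Im a)\<^sup>2" using ge ib by (intro power_mono) auto
  have "(Re a)\<^sup>2 * (Im a)\<^sup>2 \<le> (Re b)\<^sup>2 * (Im a)\<^sup>2"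
    unfolding e2 using ge2 by (intro mult_left_mono) auto
  then have "(Re a)\<^sup>2 \<le> (Re b)\<^sup>2" using ia by (simp add: mult_le_cancel_right)
  then have "(Im a)\<^sup>2 \<le> (Im b)\<^sup>2 + 1 / real n" using r by linarith
  then show "(Im (slit_map n x z))\<^sup>2 \<le> (Im z)\<^sup>2 + 1 / real n" by (simp add: a_def b_def)
qed

text \<open>By the product identity the new real part is a convex combination of \<open>Re z\<close>
  and \<open>x\<close>, with weight \<open>Im z / Im (slit_map n x z) \<le> 1\<close> on
  \<open>Re z\<close>.\<close>

lemma Re_slit_map_between:
  assumes "Im z > 0"
  shows "Re (slit_map n x z) \<le> max (Re z) x" "min (Re z) x \<le> Re (slit_map n x z)"
proof -
  note g = slit_map_geometry[OF assms, of n x]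
  define q where "q = Im z / Im (slit_map n x z)"
  have q: "0 \<le> q" "q \<le> 1" using g assms by (auto simp: q_def)
  have "Re (slit_map n x z) - x = (Re z - x) * q"
    using g(1,2) by (simp add: q_def field_simps)
  then have e: "Re (slit_map n x z) = q * Re z + (1 - q) * x" by (simp add: algebra_simps)
  have "q * Re z + (1 - q) * x \<le> q * max (Re z) x + (1 - q) * max (Re z) x"
    using q by (intro add_mono mult_left_mono) auto
  then show "Re (slit_map n x z) \<le> max (Re z) x" unfolding e by (simp add: algebra_simps)
  have "q * min (Re z) x + (1 - q) * min (Re z) x \<le> q * Re z + (1 - q) * x"
    using q by (intro add_mono mult_left_mono) auto
  then show "min (Re z) x \<le> Re (slit_map n x z)" unfolding e by (simp add: algebra_simps)
qed

lemma cluster_map_upper_half_plane: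
  assumes "Im z > 0"
  shows "Im (cluster_map n x k z) > 0" "Im z \<le> Im (cluster_map n x k z)"
    "(Im (cluster_map n x k z))\<^sup>2 \<le> (Im z)\<^sup>2 + real k / real n"
proof -
  have "Im (cluster_map n x k z) > 0 \<and> Im z \<le> Im (cluster_map n x k z) \<and>
    (Im (cluster_map n x k z))\<^sup>2 \<le> (Im z)\<^sup>2 + real k / real n"
    using assms
  proof (induction k arbitrary: z)
    case (Suc k)
    note g = slit_map_geometry[OF Suc.prems, of n "x (Suc k)"]
    show ?case using Suc.IH[OF g(1)] g by (auto simp: add_divide_distrib)
  qed simp
  then show "Im (cluster_map n x k z) > 0" "Im z \<le> Im (cluster_map n x k z)"
    "(Im (cluster_map n x k z))\<^sup>2 \<le> (Im z)\<^sup>2 + real k / real n" by auto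
qed

text \<open>One slit map moves \<open>z\<close> by at most \<open>1 / (n |z - x|)\<close>, and
  \<open>|z - x| \<ge> Im z\<close>. Each further map acts on a point that is at least as high, so
  the \<open>k\<close> displacements add up.\<close>

lemma cluster_map_sub_bound:
  assumes "Im z > 0"
  shows "norm (cluster_map n x k z - z) \<le> real k / real n / Im z"
  using assms
proof (induction k arbitrary: z)
  case (Suc k)
  let ?w = "slit_map n (x (Suc k)) z"
  note g = slit_map_geometry[OF Suc.prems, of n "x (Suc k)"]
  have "Im z \<le> norm (z - of_real (x (Suc k)))"
    using abs_Im_le_cmod[of "z - of_real (x (Suc k))"] by simp
  then have "norm (?w - z) * Im z \<le> norm (?w - z) * norm (z - of_real (x (Suc k)))"
    by (intro mult_left_mono) auto
  also have "\<dots> \<le> 1 / real n"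
    using Suc.prems by (intro slit_map_sub_bound) (simp add: upper_half_plane_def)
  finally have 1: "norm (?w - z) \<le> 1 / real n / Im z"
    using Suc.prems by (subst pos_le_divide_eq)
  have "norm (cluster_map n x k ?w - ?w) \<le> real k / real n / Im ?w"
    by (rule Suc.IH[OF g(1)])
  also have "\<dots> \<le> real k / real n / Im z"
    using g Suc.prems by (intro divide_left_mono) auto
  finally have 2: "norm (cluster_map n x k ?w - ?w) \<le> real k / real n / Im z" .
  have "norm (cluster_map n x k ?w - z) \<le> norm (cluster_map n x k ?w - ?w) + norm (?w - z)"
    using norm_triangle_ineq[of "cluster_map n x k ?w - ?w" "?w - z"] by simp
  also have "\<dots> \<le> real (Suc k) / real n / Im z"
    using 1 2 by (simp add: add_divide_distrib)
  finally show ?case by simp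
qed simp

lemma Re_cluster_map_le:
  assumes "Im z > 0" "Re z \<le> b" "\<And>j. 1 \<le> j \<Longrightarrow> j \<le> k \<Longrightarrow> x j \<le> b"
  shows "Re (cluster_map n x k z) \<le> b"
  using assms
proof (induction k arbitrary: z)
  case (Suc k)
  have "Re (slit_map n (x (Suc k)) z) \<le> b"
    using Re_slit_map_between(1)[OF Suc.prems(1), of n "x (Suc k)"] Suc.prems(2) Suc.prems(3)[of "Suc k"]
    by linarith
  then show ?case using Suc.IH[OF Im_slit_map_pos[OF Suc.prems(1)]] Suc.prems(3) by auto
qed simp

lemma Re_cluster_map_ge:
  assumes "Im z > 0" "a \<le> Re z" "\<And>j. 1 \<le> j \<Longrightarrow> j \<le> k \<Longrightarrow> a \<le> x j"
  shows "a \<le> Re (cluster_map n x k z)"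
  using assms
proof (induction k arbitrary: z)
  case (Suc k)
  have "a \<le> Re (slit_map n (x (Suc k)) z)"
    using Re_slit_map_between(2)[OF Suc.prems(1), where x="x (Suc k)" and n=n] Suc.prems(2) Suc.prems(3)[of "Suc k"]
    by linarith
  then show ?case using Suc.IH[OF Im_slit_map_pos[OF Suc.prems(1)]] Suc.prems(3) by auto
qed simp

lemma slit_map_inj:
  assumes "Im z > 0" "Im w > 0" "slit_map n x z = slit_map n x w"
  shows "z = w"
proof -
  have "(z - of_real x)\<^sup>2 = (w - of_real x)\<^sup>2"
    using slit_map_square[of n x z] slit_map_square[of n x w] assms(3) by simp
  then have "z - of_real x = w - of_real x \<or> z - of_real x = - (w - of_real x)"
    by (simp add: power2_eq_iff)
  then show ?thesis
  proof
    assume "z - of_real x = - (w - of_real x)"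
    then have "Im z = - Im w" by (metis Im_complex_of_real diff_zero minus_complex.sel(2) uminus_complex.sel(2))
    then show ?thesis using assms by simp
  qed simp
qed

lemma cluster_map_inj:
  assumes "Im z > 0" "Im w > 0" "cluster_map n x k z = cluster_map n x k w"
  shows "z = w"
  using assms
proof (induction k arbitrary: z w)
  case (Suc k)
  show ?case
    using Suc.IH[OF Im_slit_map_pos Im_slit_map_pos] Suc.prems slit_map_inj by fastforce
qed simp

text \<open>Particle number \<open>j + 1\<close>, parametrised by the height \<open>s\<close> on its
  straight slit before the earlier maps bend it.\<close>

definition slit_point :: "nat \<Rightarrow> (nat \<Rightarrow> real) \<Rightarrow> nat \<Rightarrow> real \<Rightarrow> complex" where
  "slit_point n x j s = cluster_map n x j (Complex (x (Suc j)) s)"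

text \<open>Each new map removes one straight slit from the half-plane, and injectivity of the
  earlier composition turns the image of this set difference into a difference of images. The foot
  \<open>s = 0\<close> is absent because the half-plane is open.\<close>

lemma complement_cluster_map_image:
  assumes "n \<ge> 1"
  shows "upper_half_plane - cluster_map n x k ` upper_half_plane =
    {slit_point n x j s | j s. j < k \<and> 0 < s \<and> s \<le> 1 / sqrt (real n)}"
proof (induction k)
  case (Suc k)
  let ?H = upper_half_plane and ?S = "{Complex (x (Suc k)) s | s. 0 < s \<and> s \<le> 1 / sqrt (real n)}"
  have S: "?S \<subseteq> ?H" by (auto simp: upper_half_plane_def)
  have F: "slit_map n (x (Suc k)) ` ?H = ?H - ?S"
    unfolding slit_map_image[OF assms] by (force simp: upper_half_plane_def)
  have inj: "inj_on (cluster_map n x k) ?H"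
    by (rule inj_onI) (auto simp: upper_half_plane_def intro: cluster_map_inj)
  have sub: "cluster_map n x k ` ?H \<subseteq> ?H"
    using cluster_map_upper_half_plane by (auto simp: upper_half_plane_def)
  have "cluster_map n x (Suc k) ` ?H = cluster_map n x k ` (?H - ?S)"
    unfolding F[symmetric] by (simp add: image_comp)
  also have "\<dots> = cluster_map n x k ` ?H - cluster_map n x k ` ?S"
    by (rule inj_on_image_set_diff[OF inj _ S]) blast
  finally have "?H - cluster_map n x (Suc k) ` ?H =
    (?H - cluster_map n x k ` ?H) \<union> cluster_map n x k ` ?S"
    using sub S by blast
  also have "cluster_map n x k ` ?S = {slit_point n x k s | s. 0 < s \<and> s \<le> 1 / sqrt (real n)}"
    by (auto simp: slit_point_def)
  finally show ?case unfolding Suc.IH by (auto simp: less_Suc_eq)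
qed simp

lemma cluster_eq:
  assumes "n \<ge> 1"
  shows "cluster n x k = closure {slit_point n x j s | j s. j < k \<and> 0 < s \<and> s \<le> 1 / sqrt (real n)}"
  unfolding cluster_def complement_cluster_map_image[OF assms] ..

lemma slit_point_mem_cluster:
  assumes "n \<ge> 1" "j < k" "0 < s" "s \<le> 1 / sqrt (real n)"
  shows "slit_point n x j s \<in> cluster n x k"
  unfolding cluster_eq[OF assms(1)] using assms by (intro subsetD[OF closure_subset]) auto

lemma cluster_subset_closed:
  assumes "n \<ge> 1" "closed C"
    and "\<And>j s. j < k \<Longrightarrow> 0 < s \<Longrightarrow> s \<le> 1 / sqrt (real n) \<Longrightarrow> slit_point n x j s \<in> C"
  shows "cluster n x k \<subseteq> C"
  unfolding cluster_eq[OF assms(1)] using assms(2,3) by (intro closure_minimal) auto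

lemma Im_slit_point:
  assumes "n \<ge> 1" "j < k" "0 < s" "s \<le> 1 / sqrt (real n)"
  shows "0 < Im (slit_point n x j s)" "Im (slit_point n x j s) \<le> sqrt (real k / real n)"
proof -
  have p: "0 < Im (Complex (x (Suc j)) s)" using assms by simp
  note c = cluster_map_upper_half_plane[OF p, where n=n and x=x and k=j]
  show "0 < Im (slit_point n x j s)" using c(1) by (simp add: slit_point_def)
  have "s\<^sup>2 \<le> (1 / sqrt (real n))\<^sup>2" using assms by (intro power_mono) auto
  then have "(Im (slit_point n x j s))\<^sup>2 \<le> 1 / real n + real j / real n"
    using c(3) by (simp add: slit_point_def power_divide)
  also have "\<dots> = real (Suc j) / real n" by (simp add: add_divide_distrib)
  also have "\<dots> \<le> real k / real n" using assms(2) by (intro divide_right_mono) auto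
  finally show "Im (slit_point n x j s) \<le> sqrt (real k / real n)" by (rule real_le_rsqrt)
qed

lemma Re_slit_point:
  assumes "0 < s" "\<And>i. 1 \<le> i \<Longrightarrow> i \<le> Suc j \<Longrightarrow> a \<le> x i \<and> x i \<le> b"
  shows "a \<le> Re (slit_point n x j s)" "Re (slit_point n x j s) \<le> b"
proof -
  have p: "0 < Im (Complex (x (Suc j)) s)" using assms(1) by simp
  show "a \<le> Re (slit_point n x j s)"
    unfolding slit_point_def by (rule Re_cluster_map_ge[OF p]) (simp_all add: assms(2))
  show "Re (slit_point n x j s) \<le> b"
    unfolding slit_point_def by (rule Re_cluster_map_le[OF p]) (simp_all add: assms(2))
qed

lemma cluster_subset_rectangle:
  assumes "n \<ge> 1" "\<And>i. 1 \<le> i \<Longrightarrow> i \<le> k \<Longrightarrow> a \<le> x i \<and> x i \<le> b"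
  shows "cluster n x k \<subseteq> cbox (Complex a 0) (Complex b (sqrt (real k / real n)))"
proof (rule cluster_subset_closed[OF assms(1)])
  fix j s assume *: "j < k" "0 < s" "s \<le> 1 / sqrt (real n)"
  then have "a \<le> Re (slit_point n x j s)" "Re (slit_point n x j s) \<le> b"
    using assms(2) Re_slit_point[OF *(2), of j a x b n] by auto
  with Im_slit_point[OF assms(1) *, of x]
  show "slit_point n x j s \<in> cbox (Complex a 0) (Complex b (sqrt (real k / real n)))"
    by (auto simp: in_cbox_complex_iff)
qed (rule closed_cbox)

lemma compact_cluster:
  assumes "n \<ge> 1"
  shows "compact (cluster n x k)"
proof -
  define B where "B = Max (insert 0 ((\<lambda>i. \<bar>x i\<bar>) ` {1..k}))"
  have B: "\<bar>x i\<bar> \<le> B" if "1 \<le> i" "i \<le> k" for i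
    unfolding B_def using that by (intro Max_ge) auto
  have "cluster n x k \<subseteq> cbox (Complex (-B) 0) (Complex B (sqrt (real k / real n)))"
    using B by (intro cluster_subset_rectangle assms) (fastforce simp: abs_le_iff)
  then have "bounded (cluster n x k)" using bounded_cbox bounded_subset by blast
  moreover have "closed (cluster n x k)" by (simp add: cluster_def)
  ultimately show ?thesis by (simp add: compact_eq_bounded_closed)
qed

text \<open>Compactness supplies an actual maximum; its bound is the height bound for slit points,
  which passes to the closure.\<close>

lemma cluster_Im_max:
  assumes "n \<ge> 1" "k \<ge> 1"
  obtains z where "z \<in> cluster n x k" "\<And>w. w \<in> cluster n x k \<Longrightarrow> Im w \<le> Im z"
    "Im z \<le> sqrt (real k / real n)"
proof -
  have "slit_point n x 0 (1 / sqrt (real n)) \<in> cluster n x k"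
    using assms by (intro slit_point_mem_cluster) auto
  then have ne: "cluster n x k \<noteq> {}" by auto
  obtain z where z: "z \<in> cluster n x k" "\<And>w. w \<in> cluster n x k \<Longrightarrow> Im w \<le> Im z"
    using continuous_attains_sup[OF compact_cluster[OF assms(1)] ne continuous_on_Im[OF continuous_on_id]]
    by blast
  have "cluster n x k \<subseteq> {w. Im w \<le> sqrt (real k / real n)}"
    using Im_slit_point(2)[OF assms(1)]
    by (intro cluster_subset_closed assms(1) closed_halfspace_Im_le) simp
  with z that show ?thesis by blast
qed

section \<open>The inverse map to the right of the cluster\<close>

text \<open>
  Factoring out \<open>z - x\<close> makes the formula odd about \<open>x\<close>, so it is the right branch in both half-planes
  and is holomorphic off the slit and its mirror image.
\<close>

definition slit_inverse :: "nat \<Rightarrow> real \<Rightarrow> complex \<Rightarrow> complex" where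
  "slit_inverse n x z = of_real x + (z - of_real x) * csqrt (1 + of_real (1 / real n) / (z - of_real x)\<^sup>2)"

definition off_slit :: "nat \<Rightarrow> real \<Rightarrow> complex \<Rightarrow> bool" where
  "off_slit n x z \<longleftrightarrow> Re z \<noteq> x \<or> 1 / real n < (Im z)\<^sup>2"

text \<open>With \<open>v = z - x\<close>, a nonpositive real radicand would make
  \<open>v\<^sup>2\<close> a negative real that is at least \<open>-1/n\<close>, which puts
  \<open>z\<close> on the slit or its mirror image.\<close>

lemma off_slit_radicand:
  assumes "off_slit n x z"
  shows "1 + of_real (1 / real n) / (z - of_real x)\<^sup>2 \<notin> \<real>\<^sub>\<le>\<^sub>0" "z - of_real x \<noteq> 0"
proof -
  define v where "v = z - of_real x"
  have v: "Re v \<noteq> 0 \<or> 1 / real n < (Im v)\<^sup>2"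
    using assms by (auto simp: off_slit_def v_def)
  have c: "1 / real n \<ge> 0" by simp
  show v0: "z - of_real x \<noteq> 0" using v c unfolding v_def[symmetric] by auto
  then have v20: "v\<^sup>2 \<noteq> 0" by (simp add: v_def)
  show "1 + of_real (1 / real n) / (z - of_real x)\<^sup>2 \<notin> \<real>\<^sub>\<le>\<^sub>0"
  proof
    assume "1 + of_real (1 / real n) / (z - of_real x)\<^sup>2 \<in> \<real>\<^sub>\<le>\<^sub>0"
    then obtain r where r: "r \<le> 0" "1 + of_real (1 / real n) / v\<^sup>2 = complex_of_real r"
      unfolding v_def nonpos_Reals_def by auto
    then have "of_real (1 / real n) / v\<^sup>2 = complex_of_real (r - 1)" by (simp add: algebra_simps)
    then have e: "complex_of_real (1 / real n) = of_real (r - 1) * v\<^sup>2"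
      by (subst (asm) nonzero_divide_eq_eq[OF v20])
    have e1: "1 / real n = (r - 1) * ((Re v)\<^sup>2 - (Im v)\<^sup>2)"
      using arg_cong[OF e, of Re] by (simp add: Re_power2)
    have "0 = (r - 1) * (2 * Re v * Im v)"
      using arg_cong[OF e, of Im] by (simp add: Im_power2)
    then have "Re v * Im v = 0" using r(1) by simp
    moreover have "Im v \<noteq> 0"
    proof
      assume i: "Im v = 0"
      then have "1 / real n = (r - 1) * (Re v)\<^sup>2" using e1 by simp
      moreover have "(r - 1) * (Re v)\<^sup>2 < 0"
        using r(1) v i c by (intro mult_neg_pos) auto
      ultimately show False using c by linarith
    qed
    ultimately have re: "Re v = 0" by simp
    then have "1 / real n = (1 - r) * (Im v)\<^sup>2" using e1 by (simp add: algebra_simps)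
    also have "\<dots> \<ge> 1 * (Im v)\<^sup>2" using r(1) by (intro mult_right_mono) auto
    finally show False using v re by simp
  qed
qed

text \<open>The point is the sign of the root. Since \<open>a = v * q\<close> with
  \<open>Re q > 0\<close>, the vectors \<open>a\<close> and \<open>v\<close> have positive inner
  product. As \<open>Re a * Im a = Re v * Im v\<close>, a negative \<open>Im a\<close> would make
  both terms of that inner product nonpositive.\<close>

lemma slit_inverse_upper_half_plane:
  assumes "off_slit n x z" "Im z > 0"
  shows Im_slit_inverse_pos: "Im (slit_inverse n x z) > 0"
    and slit_map_slit_inverse: "slit_map n x (slit_inverse n x z) = z"
proof -
  define v where "v = z - of_real x"
  define q where "q = csqrt (1 + of_real (1 / real n) / v\<^sup>2)"
  define a where "a = v * q"
  note rad = off_slit_radicand[OF assms(1)]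
  have v0: "v \<noteq> 0" using rad(2) by (simp add: v_def)
  have iv: "Im v > 0" using assms(2) by (simp add: v_def)
  have q: "Re q > 0" unfolding q_def v_def by (rule Re_csqrt_gt_0[OF rad(1)])
  have "a\<^sup>2 = v\<^sup>2 * (1 + of_real (1 / real n) / v\<^sup>2)"
    by (simp add: a_def q_def power_mult_distrib)
  also have "\<dots> = v\<^sup>2 + of_real (1 / real n)" using v0 by (simp add: field_simps)
  finally have sq: "a\<^sup>2 = v\<^sup>2 + of_real (1 / real n)" .
  have e: "Re a * Im a = Re v * Im v"
    using arg_cong[OF sq, of Im] by (simp add: Im_power2)
  have "a * cnj v = of_real ((norm v)\<^sup>2) * q"
    unfolding complex_norm_square a_def by (simp add: mult_ac)
  then have "Re a * Re v + Im a * Im v = (norm v)\<^sup>2 * Re q"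
    by (simp add: complex_eq_iff)
  then have pos: "Re a * Re v + Im a * Im v > 0" using q v0 by simp
  have ia: "Im a > 0"
  proof (rule ccontr)
    assume "\<not> Im a > 0"
    then have le: "Im a \<le> 0" by simp
    show False
    proof (cases "Im a = 0")
      case True
      then have "Re v = 0" using e iv by simp
      then show False using pos True by simp
    next
      case False
      with le have lt: "Im a < 0" by simp
      have "Re a = Re v * Im v / Im a" using e lt by (simp add: field_simps)
      then have "Re a * Re v = (Re v)\<^sup>2 * Im v / Im a" by (simp add: power2_eq_square)
      also have "\<dots> \<le> 0" using lt iv by (simp add: divide_le_0_iff)
      finally have "Re a * Re v \<le> 0" .
      moreover have "Im a * Im v < 0" using lt iv by (simp add: mult_neg_pos)
      ultimately show False using pos by linarith
    qed
  qed
  have G: "slit_inverse n x z = of_real x + a"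
    by (simp add: slit_inverse_def a_def q_def v_def)
  show "Im (slit_inverse n x z) > 0" using ia by (simp add: G)
  have "1 / of_nat n - a\<^sup>2 = - (v\<^sup>2)" unfolding sq by simp
  then have "slit_map n x (slit_inverse n x z) = of_real x + \<i> * csqrt (- (v\<^sup>2))"
    by (simp add: slit_map_def G)
  also have "\<dots> = z" unfolding ii_csqrt_minus_square[OF iv] by (simp add: v_def)
  finally show "slit_map n x (slit_inverse n x z) = z" .
qed

text \<open>\<open>csqrt\<close> commutes with conjugation off its cut. This symmetry carries facts
  from the upper half-plane to the lower one.\<close>

lemma slit_inverse_cnj:
  assumes "off_slit n x z"
  shows "slit_inverse n x (cnj z) = cnj (slit_inverse n x z)"
  using cnj_csqrt[OF off_slit_radicand(1)[OF assms]]
  by (simp add: slit_inverse_def)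

text \<open>To the right of the slit the formula becomes the recursion step of
  \<open>right_end\<close>; this is how the end of the interval is read off from the inverse
  map.\<close>

lemma slit_inverse_of_real:
  assumes "x < r"
  shows "slit_inverse n x (of_real r) = of_real (x + sqrt ((r - x)\<^sup>2 + 1 / real n))"
proof -
  have c: "0 \<le> 1 + (1 / real n) / (r - x)\<^sup>2" by simp
  have "csqrt (1 + of_real (1 / real n) / (of_real r - of_real x)\<^sup>2)
      = csqrt (of_real (1 + (1 / real n) / (r - x)\<^sup>2))"
    by simp
  also have "\<dots> = of_real (sqrt (1 + (1 / real n) / (r - x)\<^sup>2))"
    using c by (rule of_real_sqrt[symmetric])
  finally have "slit_inverse n x (of_real r) = of_real (x + (r - x) * sqrt (1 + (1 / real n) / (r - x)\<^sup>2))"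
    by (simp add: slit_inverse_def)
  moreover have "(r - x) * sqrt (1 + (1 / real n) / (r - x)\<^sup>2) = sqrt ((r - x)\<^sup>2 + 1 / real n)"
  proof -
    have "(r - x) * sqrt (1 + (1 / real n) / (r - x)\<^sup>2) = sqrt ((r - x)\<^sup>2 * (1 + (1 / real n) / (r - x)\<^sup>2))"
      using assms by (simp add: real_sqrt_mult)
    also have "(r - x)\<^sup>2 * (1 + (1 / real n) / (r - x)\<^sup>2) = (r - x)\<^sup>2 + 1 / real n"
      using assms by (simp add: distrib_left)
    finally show ?thesis .
  qed
  ultimately show ?thesis by (simp only:)
qed

lemma slit_inverse_holomorphic:
  assumes "f holomorphic_on U" "\<And>z. z \<in> U \<Longrightarrow> off_slit n x (f z)"
  shows "(\<lambda>z. slit_inverse n x (f z)) holomorphic_on U"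
  unfolding slit_inverse_def
  by (intro holomorphic_intros assms(1)) (use off_slit_radicand[OF assms(2)] in auto)

text \<open>Particles are undone from the first to the last, by an explicit formula that is also
  meaningful on the real axis and below it.\<close>

fun cluster_inverse :: "nat \<Rightarrow> (nat \<Rightarrow> real) \<Rightarrow> nat \<Rightarrow> complex \<Rightarrow> complex" where
  "cluster_inverse n x 0 z = z"
| "cluster_inverse n x (Suc k) z = slit_inverse n (x (Suc k)) (cluster_inverse n x k z)"

lemma sqrt_shift_mono:
  fixes x r s c :: real
  assumes "x \<le> r" "r < s" "0 \<le> c"
  shows "x + sqrt ((r - x)\<^sup>2 + c) < x + sqrt ((s - x)\<^sup>2 + c)"
  using assms by (auto intro!: power_strict_mono)

section \<open>Continuation of the inverse map to a half-plane right of the cluster\<close>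

context
  fixes n k :: nat and x :: "nat \<Rightarrow> real" and b :: real
  assumes n: "n \<ge> 1" and b0: "0 \<le> b"
    and x_le: "\<And>j. j < k \<Longrightarrow> x (Suc j) \<le> right_end n x j"
    and b: "\<And>j s. j < k \<Longrightarrow> 0 < s \<Longrightarrow> s \<le> 1 / sqrt (real n) \<Longrightarrow> Re (slit_point n x j s) \<le> b"
begin

text \<open>The invariant of the induction on \<open>j\<close>. The first clause lets a point that
  hits the next slit be recognised as a cluster point, the second keeps real points to the right of
  that slit, and the third handles the lower half-plane.\<close>

definition inverse_at :: "nat \<Rightarrow> complex \<Rightarrow> bool" where
  "inverse_at j z \<longleftrightarrow>
    (Im z > 0 \<longrightarrow> Im (cluster_inverse n x j z) > 0 \<and> cluster_map n x j (cluster_inverse n x j z) = z) \<and>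
    (Im z = 0 \<longrightarrow> (\<exists>r > right_end n x j. cluster_inverse n x j z = of_real r)) \<and>
    cluster_inverse n x j (cnj z) = cnj (cluster_inverse n x j z)"

text \<open>If the partial inverse of \<open>z\<close> lay on the next slit, \<open>z\<close> itself
  would be a slit point and have real part at most \<open>b\<close>. A real \<open>z\<close> is sent
  beyond \<open>right_end n x j\<close>, hence beyond \<open>x (Suc j)\<close>.\<close>

lemma off_slit_upper:
  assumes "j < k" "Re z > b" "inverse_at j z" "Im z \<ge> 0"
  shows "off_slit n (x (Suc j)) (cluster_inverse n x j z)"
proof (cases "Im z = 0")
  case True
  then obtain r where "r > right_end n x j" "cluster_inverse n x j z = of_real r"
    using assms(3) by (auto simp: inverse_at_def)
  then show ?thesis using x_le[OF assms(1)] by (simp add: off_slit_def)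
next
  case False
  let ?w = "cluster_inverse n x j z"
  have w: "Im ?w > 0" "cluster_map n x j ?w = z"
    using False assms(3,4) by (auto simp: inverse_at_def)
  show ?thesis
  proof (rule ccontr)
    assume "\<not> off_slit n (x (Suc j)) ?w"
    then have e: "Re ?w = x (Suc j)" and "(Im ?w)\<^sup>2 \<le> 1 / real n"
      by (auto simp: off_slit_def)
    then have "Im ?w \<le> sqrt (1 / real n)" by (intro real_le_rsqrt)
    then have "Im ?w \<le> 1 / sqrt (real n)" by (simp add: real_sqrt_divide)
    moreover have "slit_point n x j (Im ?w) = z"
      using w(2) by (simp add: slit_point_def e[symmetric])
    ultimately show False using b[OF assms(1) w(1)] assms(2) by simp
  qed
qed

lemma off_slit_cnj: "off_slit n y (cnj z) = off_slit n y z"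
  by (simp add: off_slit_def)

lemma off_slit_inverse:
  assumes "j < k" "Re z > b" "inverse_at j z" "inverse_at j (cnj z)"
  shows "off_slit n (x (Suc j)) (cluster_inverse n x j z)"
proof (cases "Im z \<ge> 0")
  case False
  have "off_slit n (x (Suc j)) (cluster_inverse n x j (cnj z))"
    using False assms by (intro off_slit_upper) auto
  moreover have "cluster_inverse n x j z = cnj (cluster_inverse n x j (cnj z))"
    using assms(3) by (simp add: inverse_at_def)
  ultimately show ?thesis by (simp add: off_slit_cnj)
qed (use assms off_slit_upper in auto)

lemma inverse_at_all:
  assumes "j \<le> k" "Re z > b"
  shows "inverse_at j z"
  using assms
proof (induction j arbitrary: z)
  case 0
  \<comment> \<open>Here \<open>b \<ge> 0\<close> enters: a real point beyond \<open>b\<close> is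
    beyond \<open>right_end n x 0 = 0\<close>.\<close>
  have "\<exists>r>0. z = of_real r" if "Im z = 0"
    using that 0 b0 by (intro exI[of _ "Re z"]) (auto simp: complex_eq_iff)
  then show ?case by (auto simp: inverse_at_def)
next
  case (Suc j)
  have IH: "inverse_at j z" "inverse_at j (cnj z)" using Suc by auto
  have off: "off_slit n (x (Suc j)) (cluster_inverse n x j z)"
    using IH Suc.prems by (intro off_slit_inverse) auto
  have "Im (cluster_inverse n x (Suc j) z) > 0 \<and> cluster_map n x (Suc j) (cluster_inverse n x (Suc j) z) = z"
    if "Im z > 0"
    using IH(1) that slit_inverse_upper_half_plane[OF off] by (auto simp: inverse_at_def)
  moreover have "\<exists>r > right_end n x (Suc j). cluster_inverse n x (Suc j) z = of_real r" if "Im z = 0"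
  proof -
    obtain r where r: "r > right_end n x j" "cluster_inverse n x j z = of_real r"
      using IH(1) \<open>Im z = 0\<close> by (auto simp: inverse_at_def)
    have xr: "x (Suc j) \<le> right_end n x j" using x_le Suc.prems by simp
    have "right_end n x (Suc j) < x (Suc j) + sqrt ((r - x (Suc j))\<^sup>2 + 1 / real n)"
      using sqrt_shift_mono[OF xr r(1), of "1 / real n"] by simp
    moreover have "cluster_inverse n x (Suc j) z = of_real (x (Suc j) + sqrt ((r - x (Suc j))\<^sup>2 + 1 / real n))"
      using slit_inverse_of_real[of "x (Suc j)" r n] r xr by simp
    ultimately show ?thesis by blast
  qed
  moreover have "cluster_inverse n x (Suc j) (cnj z) = cnj (cluster_inverse n x (Suc j) z)"
    using IH(1) slit_inverse_cnj[OF off] by (simp add: inverse_at_def)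
  ultimately show ?case by (simp add: inverse_at_def)
qed

lemma cluster_inverse_holomorphic:
  assumes "j \<le> k"
  shows "cluster_inverse n x j holomorphic_on {z. Re z > b}"
  using assms
proof (induction j)
  case (Suc j)
  have "(\<lambda>z. slit_inverse n (x (Suc j)) (cluster_inverse n x j z)) holomorphic_on {z. Re z > b}"
    using Suc inverse_at_all[of j] by (intro slit_inverse_holomorphic off_slit_inverse) auto
  then show ?case by (rule holomorphic_transform) simp
next
  case 0
  show ?case by (rule holomorphic_transform[OF holomorphic_on_ident]) simp
qed

text \<open>Write \<open>s = sqrt (k/n)\<close>. From
  \<open>(Im z)\<^sup>2 \<le> (Im w)\<^sup>2 + s\<^sup>2\<close> for the preimage \<open>w\<close>,
  the height drops by at most \<open>s\<close>. A point at height \<open>2 s\<close> thus has a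
  preimage at height at least \<open>s\<close>, where \<open>cluster_map_sub_bound\<close> gives
  \<open>s\<^sup>2 / s = s\<close>.\<close>

lemma cluster_inverse_displacement:
  assumes "Re z > b"
  shows "\<bar>Im (cluster_inverse n x k z - z)\<bar> \<le> sqrt (real k / real n)"
    and "Im z = 2 * sqrt (real k / real n) \<Longrightarrow> norm (cluster_inverse n x k z - z) \<le> sqrt (real k / real n)"
proof -
  let ?s = "sqrt (real k / real n)"
  have up: "Im (cluster_inverse n x k z) \<le> Im z \<and> Im z \<le> Im (cluster_inverse n x k z) + ?s"
    if "Im z > 0" "Re z > b" for z
  proof -
    let ?w = "cluster_inverse n x k z"
    have w: "Im ?w > 0" "cluster_map n x k ?w = z"
      using inverse_at_all[of k z] that by (auto simp: inverse_at_def)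
    note c = cluster_map_upper_half_plane[OF w(1), of n x k]
    have "(Im z)\<^sup>2 \<le> (Im ?w)\<^sup>2 + ?s\<^sup>2" using c(3) w(2) by simp
    also have "\<dots> \<le> (Im ?w + ?s)\<^sup>2" using w(1) by (simp add: power2_sum)
    finally have "Im z \<le> Im ?w + ?s" by (rule power2_le_imp_le) (use w(1) in auto)
    then show ?thesis using c(2) w(2) by simp
  qed
  show "\<bar>Im (cluster_inverse n x k z - z)\<bar> \<le> ?s"
  proof (rule linorder_cases[of "Im z" 0])
    assume "Im z < 0"
    moreover have "cluster_inverse n x k (cnj z) = cnj (cluster_inverse n x k z)"
      using inverse_at_all[of k z] assms by (simp add: inverse_at_def)
    ultimately show ?thesis using up[of "cnj z"] assms by auto
  next
    assume "Im z = 0"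
    then obtain r where "cluster_inverse n x k z = of_real r"
      using inverse_at_all[of k z] assms by (auto simp: inverse_at_def)
    then show ?thesis using \<open>Im z = 0\<close> by simp
  next
    assume "Im z > 0"
    then show ?thesis using up[of z] assms by auto
  qed
  assume im: "Im z = 2 * ?s"
  let ?w = "cluster_inverse n x k z"
  show "norm (?w - z) \<le> ?s"
  \<comment> \<open>For \<open>k = 0\<close> the scale vanishes and cannot be divided by, but then
    the inverse is the identity.\<close>
  proof (cases "k = 0")
    case False
    then have s: "?s > 0" using n by simp
    then have z: "Im z > 0" using im by simp
    have w: "Im ?w > 0" "cluster_map n x k ?w = z"
      using inverse_at_all[of k z] assms z by (auto simp: inverse_at_def)
    have ws: "?s \<le> Im ?w" using up[OF z assms] im by linarith
    have "norm (?w - z) \<le> real k / real n / Im ?w"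
      using cluster_map_sub_bound[OF w(1), of n x k] w(2) by (simp add: norm_minus_commute)
    also have "\<dots> \<le> real k / real n / ?s"
      using ws s w(1) by (intro divide_left_mono mult_pos_pos) auto
    also have "\<dots> = ?s" by (rule real_div_sqrt) simp
    finally show ?thesis .
  next
    case True
    then show ?thesis by simp
  qed
qed

text \<open>Only \<open>Im g\<close> is controlled, so \<open>g\<close> is replaced by
  \<open>E = exp (\<i> g / s)\<close>, whose modulus lies between \<open>exp (-1)\<close> and
  \<open>exp 1\<close>. The disc of radius \<open>s\<close> about \<open>z\<close> stays in the
  half-plane, Cauchy's inequality gives \<open>|E'| \<le> exp 1 / s\<close>, and dividing by
  \<open>|E|\<close> gives \<open>|g'| \<le> exp 2\<close>.\<close>

lemma cluster_inverse_deriv: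
  assumes "s > 0" "s = sqrt (real k / real n)" "Re z \<ge> b + 2 * s"
  shows "norm (deriv (\<lambda>z. cluster_inverse n x k z - z) z) \<le> exp 2"
proof -
  define g where "g = (\<lambda>z. cluster_inverse n x k z - z)"
  let ?U = "{z. Re z > b}"
  have U: "open ?U" by (rule open_halfspace_Re_gt)
  have g: "g holomorphic_on ?U"
    unfolding g_def by (intro holomorphic_intros cluster_inverse_holomorphic) simp
  define E where "E z = exp (\<i> * g z / of_real s)" for z
  have E: "E holomorphic_on ?U"
    unfolding E_def using assms(1) by (intro holomorphic_intros g) auto
  have sub: "cball z s \<subseteq> ?U"
  proof
    fix w assume "w \<in> cball z s"
    then have "\<bar>Re (z - w)\<bar> \<le> s" using abs_Re_le_cmod[of "z - w"] by (auto simp: dist_norm)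
    then have "Re z - Re w \<le> s" by simp
    then show "w \<in> ?U" using assms(1,3) by simp
  qed
  have z: "z \<in> ?U" using assms(1,3) by auto
  have nE: "norm (E w) \<le> exp 1" "exp (-1) \<le> norm (E w)" if "w \<in> ?U" for w
  proof -
    have "\<bar>Im (g w)\<bar> \<le> s"
      using cluster_inverse_displacement(1)[of w] that unfolding g_def assms(2)[symmetric] by simp
    then have "- 1 \<le> Im (g w) / s \<and> Im (g w) / s \<le> 1"
      using assms(1) by (simp add: abs_le_iff pos_divide_le_eq pos_le_divide_eq)
    moreover have "norm (E w) = exp (- (Im (g w) / s))"
      by (simp add: E_def Re_divide_of_real)
    ultimately show "norm (E w) \<le> exp 1" "exp (-1) \<le> norm (E w)" by auto
  qed
  have "norm ((deriv ^^ 1) E z) \<le> fact 1 * exp 1 / s ^ 1"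
  proof (rule Cauchy_inequality)
    show "E holomorphic_on ball z s" using E sub ball_subset_cball by (blast intro: holomorphic_on_subset)
    show "continuous_on (cball z s) E"
      using E sub by (blast intro: holomorphic_on_subset holomorphic_on_imp_continuous_on)
    show "norm (E w) \<le> exp 1" if "norm (z - w) = s" for w
      using that sub by (intro nE) (auto simp: dist_norm)
  qed (use assms in auto)
  then have 1: "norm (deriv E z) \<le> exp 1 / s" by simp
  have dg: "(g has_field_derivative deriv g z) (at z)"
    using g U z by (intro holomorphic_derivI)
  have "(E has_field_derivative (E z * (\<i> * deriv g z / of_real s))) (at z)"
    unfolding E_def by (intro DERIV_chain2[OF DERIV_exp] DERIV_cdivide DERIV_cmult dg)
  then have "deriv E z = E z * (\<i> * deriv g z / of_real s)" by (rule DERIV_imp_deriv)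
  then have "norm (E z) * norm (deriv g z) / s \<le> exp 1 / s"
    using 1 assms(1) by (simp add: norm_mult norm_divide)
  then have "norm (E z) * norm (deriv g z) \<le> exp 1"
    using assms(1) by (simp add: divide_le_cancel)
  moreover have "exp (-1) * norm (deriv g z) \<le> norm (E z) * norm (deriv g z)"
    using nE(2)[OF z] by (intro mult_right_mono) auto
  ultimately have "exp (-1) * norm (deriv g z) \<le> exp 1" by linarith
  then have "exp 1 * (exp (-1) * norm (deriv g z)) \<le> exp 1 * exp 1" by (intro mult_left_mono) auto
  then show ?thesis unfolding g_def[symmetric] by (simp add: mult.assoc[symmetric] exp_add[symmetric])
qed

text \<open>At height \<open>2 s\<close> above \<open>b + 2 s\<close> the displacement
  \<open>g\<close> is at most \<open>s\<close>. Descending to the real axis changes it by at most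
  \<open>2 s exp 2\<close>, so the real point \<open>b + 2 s\<close> is sent to at most
  \<open>b + (3 + 2 exp 2) s\<close>. Its image also exceeds the right end.\<close>

lemma right_end_le_cluster:
  shows "right_end n x k \<le> b + (3 + 2 * exp 2) * sqrt (real k / real n)"
proof (cases "k = 0")
  case False
  define s where "s = sqrt (real k / real n)"
  have s: "s > 0" using False n by (simp add: s_def)
  let ?g = "\<lambda>z. cluster_inverse n x k z - z"
  let ?z0 = "of_real (b + 2 * s) :: complex" and ?z1 = "Complex (b + 2 * s) (2 * s)"
  let ?S = "{z. Re z \<ge> b + 2 * s}"
  have "norm (?g ?z0 - ?g ?z1) \<le> exp 2 * norm (?z0 - ?z1)"
  proof (rule field_differentiable_bound[of ?S])
    show "convex ?S" by (rule convex_halfspace_Re_ge)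
    show "(?g has_field_derivative deriv ?g z) (at z within ?S)" if "z \<in> ?S" for z
    proof -
      have "?g holomorphic_on {z. Re z > b}"
        by (intro holomorphic_intros cluster_inverse_holomorphic) simp
      then have "(?g has_field_derivative deriv ?g z) (at z)"
        using that s by (intro holomorphic_derivI[OF _ open_halfspace_Re_gt]) auto
      then show ?thesis by (rule has_field_derivative_at_within)
    qed
    show "norm (deriv ?g z) \<le> exp 2" if "z \<in> ?S" for z
      using that by (intro cluster_inverse_deriv[OF s s_def]) auto
  qed auto
  also have "norm (?z0 - ?z1) = 2 * s"
    using s by (simp add: cmod_def real_sqrt_mult)
  finally have d: "norm (?g ?z0 - ?g ?z1) \<le> exp 2 * (2 * s)" .
  have g1: "norm (?g ?z1) \<le> s"
    using cluster_inverse_displacement(2)[of ?z1] s by (simp add: s_def)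
  obtain r where r: "r > right_end n x k" "cluster_inverse n x k ?z0 = of_real r"
    using inverse_at_all[of k ?z0] s by (auto simp: inverse_at_def)
  have "r - (b + 2 * s) = Re (?g ?z0)" using arg_cong[OF r(2), of Re] by simp
  also have "\<dots> \<le> norm (?g ?z0)" by (rule complex_Re_le_cmod)
  also have "\<dots> \<le> norm (?g ?z0 - ?g ?z1) + norm (?g ?z1)"
    using norm_triangle_ineq[of "?g ?z0 - ?g ?z1" "?g ?z1"] by simp
  also have "\<dots> \<le> exp 2 * (2 * s) + s" using d g1 by linarith
  finally show ?thesis using r(1) by (simp add: algebra_simps s_def[symmetric])
qed (use b0 in simp)

end

section \<open>Diameter and the image interval\<close>

text \<open>Reflection in the imaginary axis, \<open>z \<mapsto> - cnj z\<close>, amounts to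
  negating all positions. It exchanges the two ends, so bounds for the left end follow from those
  for the right one.\<close>

lemma slit_map_mirror:
  assumes "Im z > 0"
  shows "slit_map n (- x) (- cnj z) = - cnj (slit_map n x z)"
proof -
  have "z \<in> upper_half_plane" using assms by (simp add: upper_half_plane_def)
  note c = cnj_csqrt[OF slit_map_radicand[OF this, of n x]]
  have "(- cnj z - of_real (- x))\<^sup>2 = (cnj z - of_real x)\<^sup>2"
    by (simp add: power2_commute)
  then show ?thesis using c by (simp add: slit_map_def)
qed

lemma cluster_map_mirror:
  assumes "Im z > 0"
  shows "cluster_map n (\<lambda>j. - x j) k (- cnj z) = - cnj (cluster_map n x k z)"
  using assms
proof (induction k arbitrary: z)
  case (Suc k)
  then show ?case using Im_slit_map_pos[of z n "x (Suc k)"] by (simp add: slit_map_mirror)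
qed simp

lemma slit_point_mirror:
  assumes "0 < s"
  shows "slit_point n (\<lambda>j. - x j) k s = - cnj (slit_point n x k s)"
proof -
  have "Complex (- x (Suc k)) s = - cnj (Complex (x (Suc k)) s)" by (simp add: complex_eq_iff)
  then show ?thesis using assms by (simp add: slit_point_def cluster_map_mirror)
qed

lemma right_end_mirror: "right_end n (\<lambda>j. - x j) k = left_end n x k"
  by (induction k) simp_all

text \<open>The case \<open>j = 0\<close> is included: both ends are then 0, which forces
  \<open>x 1 = 0\<close>.\<close>

definition feasible :: "nat \<Rightarrow> (nat \<Rightarrow> real) \<Rightarrow> nat \<Rightarrow> bool" where
  "feasible n x k \<longleftrightarrow> (\<forall>j<k. - left_end n x j \<le> x (Suc j) \<and> x (Suc j) \<le> right_end n x j)"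

lemma feasible_mirror: "feasible n (\<lambda>j. - x j) k \<longleftrightarrow> feasible n x k"
  using right_end_mirror[of n "\<lambda>j. - x j"] right_end_mirror[of n x]
  by (auto simp: feasible_def)

lemma right_end_mono:
  assumes "i \<le> j"
  shows "right_end n x i \<le> right_end n x j"
proof (rule lift_Suc_mono_le[OF _ assms])
  fix k
  have "\<bar>right_end n x k - x (Suc k)\<bar> \<le> sqrt ((right_end n x k - x (Suc k))\<^sup>2 + 1 / real n)"
    by (rule real_le_rsqrt) simp
  then show "right_end n x k \<le> right_end n x (Suc k)" by simp
qed

lemma position_le_right_end:
  assumes "feasible n x k" "1 \<le> i" "i \<le> k"
  shows "x i \<le> right_end n x k"
proof -
  have "x (Suc (i - 1)) \<le> right_end n x (i - 1)"
    using assms unfolding feasible_def by (metis Suc_pred' less_eq_Suc_le One_nat_def)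
  also have "\<dots> \<le> right_end n x k" using assms by (intro right_end_mono) auto
  finally show ?thesis using assms by simp
qed

lemma position_in_interval:
  assumes "feasible n x k" "1 \<le> i" "i \<le> k"
  shows "- left_end n x k \<le> x i \<and> x i \<le> right_end n x k"
  using position_le_right_end[OF assms]
    position_le_right_end[of n "\<lambda>j. - x j" k i] assms
  by (simp add: feasible_mirror right_end_mirror)

text \<open>The cluster lies in a rectangle over the interval, and a distance is at most the sum of
  its horizontal and vertical parts.\<close>

lemma diameter_cluster_le:
  assumes "n \<ge> 1" "k \<ge> 1" "feasible n x k"
  shows "diameter (cluster n x k) \<le> left_end n x k + right_end n x k + sqrt (real k / real n)"
proof (rule diameter_le)
  have "slit_point n x 0 (1 / sqrt (real n)) \<in> cluster n x k"
    using assms by (intro slit_point_mem_cluster) auto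
  then show "cluster n x k \<noteq> {} \<or> 0 \<le> left_end n x k + right_end n x k + sqrt (real k / real n)"
    by auto
next
  fix z w assume zw: "z \<in> cluster n x k" "w \<in> cluster n x k"
  have "cluster n x k \<subseteq> cbox (Complex (- left_end n x k) 0) (Complex (right_end n x k) (sqrt (real k / real n)))"
    using position_in_interval[OF assms(3)] by (intro cluster_subset_rectangle assms(1)) auto
  from subsetD[OF this zw(1)] subsetD[OF this zw(2)]
  have "\<bar>Re (z - w)\<bar> \<le> left_end n x k + right_end n x k \<and> \<bar>Im (z - w)\<bar> \<le> sqrt (real k / real n)"
    by (simp add: in_cbox_complex_iff abs_le_iff)
  then show "norm (z - w) \<le> left_end n x k + right_end n x k + sqrt (real k / real n)"
    using cmod_le[of "z - w"] by linarith
qed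

lemma right_end_le_Re_cluster_bound:
  assumes "n \<ge> 1" "k \<ge> 1" "feasible n x k"
    and "\<And>z. z \<in> cluster n x k \<Longrightarrow> Re z \<le> b"
  shows "right_end n x k \<le> b + (3 + 2 * exp 2) * sqrt (real k / real n)"
proof (rule right_end_le_cluster[OF assms(1)])
  \<comment> \<open>The tip of the first slit has real part 0 and belongs to the cluster, so any
    bound \<open>b\<close> is nonnegative.\<close>
  have "x 1 = 0" using assms(2,3) by (auto simp: feasible_def dest: spec[of _ 0])
  moreover have "slit_point n x 0 (1 / sqrt (real n)) \<in> cluster n x k"
    using assms by (intro slit_point_mem_cluster) auto
  ultimately show "0 \<le> b" using assms(4) by (force simp: slit_point_def)
qed (use assms slit_point_mem_cluster[OF assms(1)] in \<open>auto simp: feasible_def\<close>)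

text \<open>The diameter is at least the horizontal distance between a rightmost and a leftmost
  point. Each end of the interval exceeds the corresponding extreme by at most
  \<open>(3 + 2 exp 2) sqrt (k/n)\<close>, whence the doubled constant.\<close>

lemma diameter_cluster_ge:
  assumes "n \<ge> 1" "k \<ge> 1" "feasible n x k"
  shows "left_end n x k + right_end n x k - (6 + 4 * exp 2) * sqrt (real k / real n)
    \<le> diameter (cluster n x k)"
proof -
  have p: "slit_point n x 0 (1 / sqrt (real n)) \<in> cluster n x k"
    using assms by (intro slit_point_mem_cluster) auto
  then have ne: "cluster n x k \<noteq> {}" by auto
  note comp = compact_cluster[OF assms(1)]
  obtain z where z: "z \<in> cluster n x k" "\<And>w. w \<in> cluster n x k \<Longrightarrow> Re w \<le> Re z"
    using continuous_attains_sup[OF comp ne continuous_on_Re[OF continuous_on_id]] by blast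
  obtain y where y: "y \<in> cluster n x k" "\<And>w. w \<in> cluster n x k \<Longrightarrow> Re y \<le> Re w"
    using continuous_attains_inf[OF comp ne continuous_on_Re[OF continuous_on_id]] by blast
  have 1: "right_end n x k \<le> Re z + (3 + 2 * exp 2) * sqrt (real k / real n)"
    using z(2) by (intro right_end_le_Re_cluster_bound assms)
  have "right_end n (\<lambda>j. - x j) k \<le> - Re y + (3 + 2 * exp 2) * sqrt (real k / real n)"
  proof (rule right_end_le_Re_cluster_bound)
    show "Re w \<le> - Re y" if "w \<in> cluster n (\<lambda>j. - x j) k" for w
    proof -
      have "cluster n (\<lambda>j. - x j) k \<subseteq> {w. Re w \<le> - Re y}"
        using slit_point_mem_cluster[OF assms(1)] y(2)
        by (intro cluster_subset_closed assms(1) closed_halfspace_Re_le)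
          (simp add: slit_point_mirror)
      then show ?thesis using that by auto
    qed
  qed (use assms in \<open>simp_all add: feasible_mirror\<close>)
  then have 2: "left_end n x k \<le> - Re y + (3 + 2 * exp 2) * sqrt (real k / real n)"
    by (simp add: right_end_mirror)
  have "Re z - Re y \<le> norm (z - y)" using complex_Re_le_cmod[of "z - y"] by simp
  also have "\<dots> \<le> diameter (cluster n x k)"
    using diameter_bounded_bound[OF compact_imp_bounded[OF comp] z(1) y(1)] by (simp add: dist_norm)
  finally show ?thesis using 1 2 by (simp add: algebra_simps)
qed

section \<open>Measurability of the diameter\<close>

lemma borel_measurable_csqrt [measurable]: "csqrt \<in> borel_measurable borel"
  unfolding borel_measurable_complex_iff by simp

lemma slit_map_measurable:
  assumes [measurable]: "y \<in> borel_measurable N" "f \<in> borel_measurable N"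
  shows "(\<lambda>\<omega>. slit_map n (y \<omega>) (f \<omega>)) \<in> borel_measurable N"
  unfolding slit_map_def by measurable

lemma cluster_map_measurable:
  assumes "\<And>j. 1 \<le> j \<Longrightarrow> j \<le> k \<Longrightarrow> Y j \<in> borel_measurable N" "f \<in> borel_measurable N"
  shows "(\<lambda>\<omega>. cluster_map n (\<lambda>j. Y j \<omega>) k (f \<omega>)) \<in> borel_measurable N"
  using assms
proof (induction k arbitrary: f)
  case (Suc k)
  have "(\<lambda>\<omega>. slit_map n (Y (Suc k) \<omega>) (f \<omega>)) \<in> borel_measurable N"
    using Suc.prems by (intro slit_map_measurable) auto
  then show ?case using Suc.IH[of "\<lambda>\<omega>. slit_map n (Y (Suc k) \<omega>) (f \<omega>)"] Suc.prems(1) by simp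
qed simp

lemma slit_point_measurable:
  assumes "\<And>j. 1 \<le> j \<Longrightarrow> j \<le> Suc k \<Longrightarrow> Y j \<in> borel_measurable N"
  shows "(\<lambda>\<omega>. slit_point n (\<lambda>j. Y j \<omega>) k s) \<in> borel_measurable N"
  unfolding slit_point_def
proof (rule cluster_map_measurable)
  have [measurable]: "Y (Suc k) \<in> borel_measurable N" using assms by simp
  show "(\<lambda>\<omega>. Complex (Y (Suc k) \<omega>) s) \<in> borel_measurable N"
    unfolding borel_measurable_complex_iff by simp
qed (use assms in simp)

lemma cluster_map_holomorphic: "cluster_map n x k holomorphic_on upper_half_plane"
proof (induction k)
  case (Suc k)
  have "slit_map n (x (Suc k)) ` upper_half_plane \<subseteq> upper_half_plane"
    using slit_map_upper_half_plane by auto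
  then show ?case
    unfolding cluster_map.simps by (intro holomorphic_on_compose_gen[OF slit_map_holomorphic Suc])
qed (simp add: id_def)

lemma isCont_slit_point:
  assumes "0 < s"
  shows "isCont (slit_point n x k) s"
proof -
  have o: "open upper_half_plane"
    unfolding upper_half_plane_def by (rule open_halfspace_Im_gt)
  have "isCont (cluster_map n x k) (Complex (x (Suc k)) s)"
    using holomorphic_on_imp_continuous_on[OF cluster_map_holomorphic] o assms
    by (simp add: continuous_on_eq_continuous_at upper_half_plane_def)
  moreover have "isCont (Complex (x (Suc k))) s"
    unfolding complex_eq_iff Complex_eq by (intro continuous_intros)
  ultimately show ?thesis
    unfolding slit_point_def[abs_def] by (rule isCont_o2[rotated])
qed

text \<open>Rational heights make the index set countable, so that the diameter becomes a countable
  supremum of measurable distances.\<close>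

definition slit_indices :: "nat \<Rightarrow> nat \<Rightarrow> (nat \<times> real) set" where
  "slit_indices n k = {(j, s). j < k \<and> s \<in> \<rat> \<and> 0 < s \<and> s \<le> 1 / sqrt (real n)}"

lemma countable_slit_indices: "countable (slit_indices n k)"
proof (rule countable_subset)
  show "slit_indices n k \<subseteq> {..<k} \<times> \<rat>" by (auto simp: slit_indices_def)
qed (auto intro: countable_rat)

lemma cluster_eq_closure_rational:
  assumes "n \<ge> 1"
  shows "cluster n x k = closure ((\<lambda>(j, s). slit_point n x j s) ` slit_indices n k)"
proof (rule antisym)
  let ?S = "(\<lambda>(j, s). slit_point n x j s) ` slit_indices n k"
  show "cluster n x k \<subseteq> closure ?S"
  proof (rule cluster_subset_closed[OF assms])
    fix j s assume js: "j < k" "0 < s" "s \<le> 1 / sqrt (real n)"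
    show "slit_point n x j s \<in> closure ?S"
      unfolding closure_approachable
    proof (intro allI impI)
      fix e :: real assume "e > 0"
      then obtain d where d: "d > 0" "\<And>s'. dist s' s < d \<Longrightarrow> dist (slit_point n x j s') (slit_point n x j s) < e"
        using isCont_slit_point[OF js(2), of n x j] unfolding continuous_at_eps_delta by blast
      \<comment> \<open>The rational height is chosen below \<open>s\<close>, so it still respects
        the upper limit \<open>1 / sqrt n\<close> when \<open>s\<close> is the tip.\<close>
      have "max 0 (s - d) < s" using js d by simp
      then obtain q where q: "q \<in> \<rat>" "max 0 (s - d) < q" "q < s" using Rats_dense_in_real by blast
      have "(j, q) \<in> slit_indices n k" using q js by (auto simp: slit_indices_def)
      moreover have "dist (slit_point n x j q) (slit_point n x j s) < e"
        using q by (intro d(2)) (auto simp: dist_real_def)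
      ultimately show "\<exists>y\<in>?S. dist y (slit_point n x j s) < e" by (intro bexI[of _ "slit_point n x j q"]) auto
    qed
  qed simp
  show "closure ?S \<subseteq> cluster n x k"
  proof (rule closure_minimal)
    show "closed (cluster n x k)" by (simp add: cluster_def)
  qed (use slit_point_mem_cluster[OF assms] in \<open>auto simp: slit_indices_def\<close>)
qed

text \<open>A bounded set and its closure have the same diameter, so the sublevel sets are countable
  intersections of conditions on pairs of rational slit points.\<close>

lemma diameter_cluster_measurable:
  assumes "n \<ge> 1" "\<And>j. 1 \<le> j \<Longrightarrow> Y j \<in> borel_measurable N"
  shows "(\<lambda>\<omega>. diameter (cluster n (\<lambda>j. Y j \<omega>) k)) \<in> borel_measurable N"
proof (cases "k = 0")
  case True
  then show ?thesis using assms(1) by (simp add: cluster_eq)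
next
  case False
  define I where "I = slit_indices n k"
  define P where "P i \<omega> = slit_point n (\<lambda>j. Y j \<omega>) (fst i) (snd i)" for i \<omega>
  have I: "countable I" unfolding I_def by (rule countable_slit_indices)
  have [measurable]: "P i \<in> borel_measurable N" for i
    unfolding P_def by (rule slit_point_measurable) (use assms(2) in simp)
  obtain q where "q \<in> \<rat>" "0 < q" "q < 1 / sqrt (real n)"
    using Rats_dense_in_real[of 0 "1 / sqrt (real n)"] assms(1) by auto
  then have ne: "(0, q) \<in> I" using False by (simp add: I_def slit_indices_def)
  have iff: "diameter (cluster n (\<lambda>j. Y j \<omega>) k) \<le> a \<longleftrightarrow> (\<forall>i\<in>I. \<forall>i'\<in>I. dist (P i \<omega>) (P i' \<omega>) \<le> a)" for \<omega> a
  proof -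
    have e: "cluster n (\<lambda>j. Y j \<omega>) k = closure ((\<lambda>i. P i \<omega>) ` I)"
      unfolding cluster_eq_closure_rational[OF assms(1)] I_def P_def by (simp add: case_prod_beta')
    have "bounded (closure ((\<lambda>i. P i \<omega>) ` I))"
      unfolding e[symmetric] by (rule compact_imp_bounded[OF compact_cluster[OF assms(1)]])
    then have b: "bounded ((\<lambda>i. P i \<omega>) ` I)"
      by (rule bounded_subset[OF _ closure_subset])
    have d: "diameter (cluster n (\<lambda>j. Y j \<omega>) k) = diameter ((\<lambda>i. P i \<omega>) ` I)"
      unfolding e by (rule diameter_closure[OF b])
    show ?thesis unfolding d
    proof
      assume "diameter ((\<lambda>i. P i \<omega>) ` I) \<le> a"
      then show "\<forall>i\<in>I. \<forall>i'\<in>I. dist (P i \<omega>) (P i' \<omega>) \<le> a"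
        using diameter_bounded_bound[OF b] by fastforce
    next
      assume "\<forall>i\<in>I. \<forall>i'\<in>I. dist (P i \<omega>) (P i' \<omega>) \<le> a"
      then show "diameter ((\<lambda>i. P i \<omega>) ` I) \<le> a"
        using ne by (intro diameter_le) (auto simp: dist_norm)
    qed
  qed
  show ?thesis
  proof (rule borel_measurableI_le)
    fix a
    \<comment> \<open>Enumerating \<open>I\<close> lets the quantifiers range over a countable
      type.\<close>
    have I_range: "I = range (from_nat_into I)"
      using range_from_nat_into[OF _ I] ne by auto
    have "{\<omega> \<in> space N. diameter (cluster n (\<lambda>j. Y j \<omega>) k) \<le> a} =
        {\<omega> \<in> space N. \<forall>i i'. dist (P (from_nat_into I i) \<omega>) (P (from_nat_into I i') \<omega>) \<le> a}"
      unfolding iff by (subst (1 2) I_range) simp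
    also have "\<dots> \<in> sets N" by measurable
    finally show "{\<omega> \<in> space N. diameter (cluster n (\<lambda>j. Y j \<omega>) k) \<le> a} \<in> sets N" .
  qed
qed

section \<open>One step of the width chain\<close>

text \<open>In units of \<open>1 / sqrt n\<close>, the distance by which an end of the interval
  advances when the particle lands at distance \<open>w\<close> from it.\<close>

definition gap :: "real \<Rightarrow> real" where
  "gap w = sqrt (w\<^sup>2 + 1) - w"

text \<open>Lengths are in units of \<open>1 / sqrt n\<close>: \<open>s\<close> is the old length
  and \<open>w\<close> the distance of the particle from the right end.\<close>

definition next_width :: "real \<Rightarrow> real \<Rightarrow> real" where
  "next_width s w = sqrt (w\<^sup>2 + 1) + sqrt ((s - w)\<^sup>2 + 1)"

lemma next_width_gap: "next_width s w = s + (gap w + gap (s - w))"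
  by (simp add: next_width_def gap_def)

text \<open>All bounds come from \<open>gap w = 1 / (r + w)\<close> with
  \<open>r = sqrt (w\<^sup>2 + 1)\<close>, \<open>w < r \<le> w + 1\<close> and
  \<open>r \<ge> 1\<close>. The two bounds with main term \<open>1 / (2 w + 1)\<close> differ by an
  integrable error; \<open>1 / (1 + w)\<close> is the one used for squares.\<close>

lemma gap_bounds:
  assumes "0 \<le> w"
  shows gap_pos: "0 < gap w" and gap_le_1: "gap w \<le> 1"
    and gap_ge: "1 / (2 * w + 1) \<le> gap w"
    and gap_le_inverse: "gap w \<le> 1 / (1 + w)"
    and gap_le: "gap w \<le> 1 / (2 * w + 1) + 2 / (2 * w + 1)\<^sup>2"
proof -
  define r where "r = sqrt (w\<^sup>2 + 1)"
  have r2: "r\<^sup>2 = w\<^sup>2 + 1" by (simp add: r_def)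
  have r_pos: "0 < r" unfolding r_def by (simp add: add_nonneg_pos)
  have w_less: "w < r" by (rule power2_less_imp_less) (use r_pos r2 in auto)
  have r_le: "r \<le> w + 1" by (rule power2_le_imp_le) (use assms r2 in \<open>auto simp: power2_sum\<close>)
  have g: "gap w = r - w" by (simp add: gap_def r_def)
  have prod: "(r - w) * (r + w) = 1" using r2 by (simp add: algebra_simps power2_eq_square)
  then have g_eq: "gap w = 1 / (r + w)" using r_pos assms by (simp add: g field_simps)
  show "0 < gap w" "gap w \<le> 1" using w_less r_le by (auto simp: g)
  show "1 / (2 * w + 1) \<le> gap w"
    unfolding g_eq using r_le r_pos assms by (intro divide_left_mono mult_pos_pos) auto
  have r_ge_1: "1 \<le> r" by (rule power2_le_imp_le) (use r_pos r2 in auto)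
  show "gap w \<le> 1 / (1 + w)"
    unfolding g_eq using r_ge_1 assms by (intro divide_left_mono mult_pos_pos) auto
  have "gap w - 1 / (2 * w + 1) = (w + 1 - r) / ((r + w) * (2 * w + 1))"
    unfolding g_eq using assms r_pos by (simp add: field_simps)
  also have "\<dots> \<le> 1 / ((r + w) * (2 * w + 1))"
    using assms r_pos w_less by (intro divide_right_mono) auto
  also have "\<dots> \<le> 1 / (((2 * w + 1) / 2) * (2 * w + 1))"
    using assms r_pos r_ge_1 w_less by (intro divide_left_mono mult_right_mono mult_pos_pos) auto
  also have "\<dots> = 2 / (2 * w + 1)\<^sup>2" by (simp add: power2_eq_square)
  finally show "gap w \<le> 1 / (2 * w + 1) + 2 / (2 * w + 1)\<^sup>2" by simp
qed

section \<open>Integrals of the increments over the interval\<close>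

text \<open>Integrands symmetric under \<open>w \<mapsto> s - w\<close> arise because the two ends move by \<open>gap w\<close> and \<open>gap (s - w)\<close>.\<close>

lemma has_integral_add_reflected:
  fixes F f :: "real \<Rightarrow> real"
  assumes "0 \<le> s" "\<And>w. 0 \<le> w \<Longrightarrow> w \<le> s \<Longrightarrow> (F has_real_derivative f w) (at w)"
  shows "((\<lambda>w. f w + f (s - w)) has_integral 2 * (F s - F 0)) {0..s}"
proof -
  have "((\<lambda>w. f w + f (s - w)) has_integral (F s - F (s - s)) - (F 0 - F (s - 0))) {0..s}"
  proof (rule fundamental_theorem_of_calculus[OF assms(1)])
    fix w assume w: "w \<in> {0..s}"
    have "((\<lambda>w. F (s - w)) has_real_derivative f (s - w) * (0 - 1)) (at w)"
      using w by (intro DERIV_chain2[of F] assms(2) derivative_intros) auto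
    moreover have "(F has_real_derivative f w) (at w)" using w assms(2) by auto
    ultimately have "((\<lambda>w. F w - F (s - w)) has_real_derivative f w - f (s - w) * (0 - 1)) (at w)"
      by (intro derivative_intros)
    then show "((\<lambda>w. F w - F (s - w)) has_vector_derivative f w + f (s - w)) (at w within {0..s})"
      by (simp add: has_real_derivative_iff_has_vector_derivative has_vector_derivative_at_within)
  qed
  then show ?thesis by simp
qed

lemma nn_integral_interval_le:
  fixes s I :: real
  assumes "(B has_integral I) {0..s}" "\<And>w. 0 \<le> w \<Longrightarrow> w \<le> s \<Longrightarrow> 0 \<le> f w \<and> f w \<le> B w"
  shows "(\<integral>\<^sup>+w. ennreal (f w) * indicator {0..s} w \<partial>lborel) \<le> ennreal I"
proof -
  have "(\<integral>\<^sup>+w. ennreal (f w) * indicator {0..s} w \<partial>lborel) \<le> (\<integral>\<^sup>+w. ennreal (B w) * indicator {0..s} w \<partial>lborel)"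
    using assms(2) by (intro nn_integral_mono) (auto simp: indicator_def intro!: ennreal_leI)
  also have "\<dots> = ennreal I"
    using assms(2) by (intro nn_integral_has_integral_lebesgue'[OF _ assms(1)]) force
  finally show ?thesis .
qed

text \<open>The source of the logarithm: this integral bounds that of the total increment from
  below.\<close>

lemma has_integral_lower:
  fixes s :: real
  assumes "0 \<le> s"
  shows "((\<lambda>w. 1 / (2 * w + 1) + 1 / (2 * (s - w) + 1)) has_integral ln (2 * s + 1)) {0..s}"
  using has_integral_add_reflected[OF assms, of "\<lambda>w. ln (2 * w + 1) / 2" "\<lambda>w. 1 / (2 * w + 1)"]
  by (force intro!: derivative_eq_intros simp: field_simps)

lemma has_integral_upper:
  fixes s :: real
  assumes "0 \<le> s"
  obtains I where "((\<lambda>w. (1 / (2 * w + 1) + 2 / (2 * w + 1)\<^sup>2) + (1 / (2 * (s - w) + 1) + 2 / (2 * (s - w) + 1)\<^sup>2))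
      has_integral I) {0..s}" "I \<le> ln (2 * s + 1) + 2"
proof
  let ?F = "\<lambda>w::real. ln (2 * w + 1) / 2 - 1 / (2 * w + 1)"
  show "((\<lambda>w. (1 / (2 * w + 1) + 2 / (2 * w + 1)\<^sup>2) + (1 / (2 * (s - w) + 1) + 2 / (2 * (s - w) + 1)\<^sup>2))
      has_integral 2 * (?F s - ?F 0)) {0..s}"
    by (rule has_integral_add_reflected[OF assms])
      (auto intro!: derivative_eq_intros simp: field_simps power2_eq_square)
  show "2 * (?F s - ?F 0) \<le> ln (2 * s + 1) + 2" using assms by simp
qed

lemma has_integral_square:
  fixes s :: real
  assumes "0 \<le> s"
  obtains I where "((\<lambda>w. (1 / (1 + w))\<^sup>2 + (1 / (1 + (s - w)))\<^sup>2) has_integral I) {0..s}" "I \<le> 2"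
proof
  let ?F = "\<lambda>w::real. - 1 / (1 + w)"
  show "((\<lambda>w. (1 / (1 + w))\<^sup>2 + (1 / (1 + (s - w)))\<^sup>2) has_integral 2 * (?F s - ?F 0)) {0..s}"
    by (rule has_integral_add_reflected[OF assms])
      (auto intro!: derivative_eq_intros simp: field_simps power2_eq_square)
  show "2 * (?F s - ?F 0) \<le> 2" using assms by simp
qed

text \<open>The last bound is the triangle inequality for the plane vectors \<open>(w, 1)\<close>
  and \<open>(s - w, 1)\<close>, whose sum \<open>(s, 2)\<close> has squared length
  \<open>s\<^sup>2 + 4\<close>. Iterated, it gives the almost sure bound
  \<open>W \<ge> 2 sqrt k\<close>.\<close>

lemma next_width_bounds:
  assumes "0 \<le> s" "0 \<le> w" "w \<le> s"
  shows "s \<le> next_width s w" "next_width s w \<le> s + 2" "s\<^sup>2 + 4 \<le> (next_width s w)\<^sup>2"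
proof -
  show s: "s \<le> next_width s w" and "next_width s w \<le> s + 2"
    using gap_bounds(1,2)[of w] gap_bounds(1,2)[of "s - w"] assms by (auto simp: next_width_gap)
  define p q where "p = sqrt (w\<^sup>2 + 1)" and "q = sqrt ((s - w)\<^sup>2 + 1)"
  have pq: "p\<^sup>2 = w\<^sup>2 + 1" "q\<^sup>2 = (s - w)\<^sup>2 + 1" "p \<ge> 0" "q \<ge> 0" by (simp_all add: p_def q_def)
  have "w * (s - w) + 1 \<le> p * q"
  proof (rule power2_le_imp_le)
    have "(w * (s - w) + 1)\<^sup>2 + (w - (s - w))\<^sup>2 = (w\<^sup>2 + 1) * ((s - w)\<^sup>2 + 1)"
      by (simp add: power2_eq_square algebra_simps)
    then show "(w * (s - w) + 1)\<^sup>2 \<le> (p * q)\<^sup>2"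
      using zero_le_power2[of "w - (s - w)"] unfolding power_mult_distrib pq(1,2) by linarith
  qed (use pq in auto)
  then have "p\<^sup>2 + q\<^sup>2 + 2 * (w * (s - w) + 1) \<le> p\<^sup>2 + q\<^sup>2 + 2 * (p * q)" by simp
  also have "\<dots> = (next_width s w)\<^sup>2"
    by (simp add: next_width_def p_def[symmetric] q_def[symmetric] power2_sum)
  also have "p\<^sup>2 + q\<^sup>2 + 2 * (w * (s - w) + 1) = s\<^sup>2 + 4"
    unfolding pq(1,2) by (simp add: power2_eq_square algebra_simps)
  finally show "s\<^sup>2 + 4 \<le> (next_width s w)\<^sup>2" .
qed

text \<open>With \<open>D\<close> the sum of the two gaps, the square is
  \<open>s\<^sup>2 + 2 s D + D\<^sup>2\<close>. Here \<open>D\<^sup>2 \<le> 4\<close>, and the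
  integral of \<open>D\<close> is at most \<open>ln (2 s + 1) + 2\<close>. The factor
  \<open>s\<close> is the missing normalisation of the uniform law.\<close>

lemma nn_integral_next_width_square:
  assumes "0 \<le> s"
  shows "(\<integral>\<^sup>+w. ennreal ((next_width s w)\<^sup>2) * indicator {0..s} w \<partial>lborel)
    \<le> ennreal (s * (s\<^sup>2 + 2 * ln (2 * s + 1) + 8))"
proof -
  obtain I where I: "((\<lambda>w. (1 / (2 * w + 1) + 2 / (2 * w + 1)\<^sup>2) + (1 / (2 * (s - w) + 1) + 2 / (2 * (s - w) + 1)\<^sup>2))
      has_integral I) {0..s}" (is "(?U has_integral _) _") and I_le: "I \<le> ln (2 * s + 1) + 2"
    using has_integral_upper[OF assms] .
  have "((\<lambda>w. (s\<^sup>2 + 4) + (2 * s) * ?U w) has_integral (s\<^sup>2 + 4) * (s - 0) + (2 * s) * I) {0..s}"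
    using has_integral_const_real[of "s\<^sup>2 + 4" 0 s] assms
    by (intro has_integral_add has_integral_mult_right I) (simp add: mult.commute)
  then have "(\<integral>\<^sup>+w. ennreal ((next_width s w)\<^sup>2) * indicator {0..s} w \<partial>lborel) \<le> ennreal ((s\<^sup>2 + 4) * (s - 0) + (2 * s) * I)"
  proof (rule nn_integral_interval_le, intro conjI)
    fix w assume w: "0 \<le> w" "w \<le> s"
    let ?D = "gap w + gap (s - w)"
    have D: "0 \<le> ?D" "?D \<le> 2" "?D \<le> ?U w"
      using gap_bounds[of w] gap_bounds[of "s - w"] w by auto
    have "?D * ?D \<le> 2 * 2" using D by (intro mult_mono) auto
    moreover have "(2 * s) * ?D \<le> (2 * s) * ?U w" using D(3) assms by (intro mult_left_mono) auto
    moreover have "(next_width s w)\<^sup>2 = s\<^sup>2 + (2 * s) * ?D + ?D * ?D"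
      unfolding next_width_gap by (simp add: power2_eq_square algebra_simps)
    ultimately show "(next_width s w)\<^sup>2 \<le> (s\<^sup>2 + 4) + (2 * s) * ?U w" by linarith
  qed simp
  also have "\<dots> \<le> ennreal (s * (s\<^sup>2 + 2 * ln (2 * s + 1) + 8))"
    using mult_left_mono[OF I_le, of "2 * s"] assms by (intro ennreal_leI) (simp add: algebra_simps)
  finally show ?thesis .
qed

section \<open>Squared downward deviations\<close>

definition neg_sq :: "real \<Rightarrow> real" where
  "neg_sq z = (min z 0)\<^sup>2"

text \<open>A second-order Taylor bound: \<open>neg_sq\<close> has derivative
  \<open>2 * min z 0\<close>, which is Lipschitz with constant 2.\<close>

lemma neg_sq_add: "neg_sq (z + d) \<le> neg_sq z + 2 * min z 0 * d + d\<^sup>2"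
proof -
  have "neg_sq (z + d) \<le> (min z 0 + d)\<^sup>2"
  proof (cases "z + d \<ge> 0")
    case False
    have "\<bar>z + d\<bar> \<le> \<bar>min z 0 + d\<bar>" using False by (auto simp: min_def)
    then have "(z + d)\<^sup>2 \<le> (min z 0 + d)\<^sup>2" by (simp only: abs_le_square_iff)
    then show ?thesis using False by (simp add: neg_sq_def)
  qed (simp add: neg_sq_def)
  then show ?thesis by (simp add: neg_sq_def power2_sum algebra_simps)
qed

text \<open>Let \<open>d\<close> be the increment of the squared width. Its mean is at least
  \<open>2 ln (2 s + 1) \<ge> l\<close>, and \<open>neg_sq\<close> is nonincreasing, so the
  first-order term contributes nothing positive. What remains is the mean of
  \<open>(d - l)\<^sup>2\<close>, where \<open>d\<^sup>2\<close> has mean at most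
  \<open>36 s\<close>.\<close>

lemma nn_integral_neg_sq_next_width:
  assumes "2 \<le> s" "0 \<le> l" "l \<le> 2 * ln (2 * s + 1)"
  shows "(\<integral>\<^sup>+w. ennreal (neg_sq ((next_width s w)\<^sup>2 - (a + l))) * indicator {0..s} w \<partial>lborel)
    \<le> ennreal (s * (neg_sq (s\<^sup>2 - a) + 36 * s + l\<^sup>2))"
proof -
  have s: "0 \<le> s" using assms by simp
  obtain J where J: "((\<lambda>w. (1 / (1 + w))\<^sup>2 + (1 / (1 + (s - w)))\<^sup>2) has_integral J) {0..s}" (is "(?Q has_integral _) _")
    and J_le: "J \<le> 2"
    using has_integral_square[OF s] .
  note L = has_integral_lower[OF s]
  let ?L = "\<lambda>w. 1 / (2 * w + 1) + 1 / (2 * (s - w) + 1)"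
  define z where "z = s\<^sup>2 - a"
  define m where "m = - 2 * min z 0"
  have m: "0 \<le> m" by (simp add: m_def)
  let ?c = "neg_sq z + m * l + l\<^sup>2"
  let ?B = "\<lambda>w. ?c - (2 * m * s) * ?L w + (8 * (s + 1)\<^sup>2) * ?Q w"
  have "(?B has_integral ?c * (s - 0) - (2 * m * s) * ln (2 * s + 1) + (8 * (s + 1)\<^sup>2) * J) {0..s}"
    using has_integral_const_real[of ?c 0 s] s
    by (intro has_integral_add has_integral_diff has_integral_mult_right J L) (simp add: mult.commute)
  then have "(\<integral>\<^sup>+w. ennreal (neg_sq ((next_width s w)\<^sup>2 - (a + l))) * indicator {0..s} w \<partial>lborel)
    \<le> ennreal (?c * (s - 0) - (2 * m * s) * ln (2 * s + 1) + (8 * (s + 1)\<^sup>2) * J)"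
  proof (rule nn_integral_interval_le, intro conjI)
    fix w assume w: "0 \<le> w" "w \<le> s"
    show "0 \<le> neg_sq ((next_width s w)\<^sup>2 - (a + l))" by (simp add: neg_sq_def)
    let ?D = "gap w + gap (s - w)"
    define d where "d = (2 * s + ?D) * ?D"
    have D: "0 \<le> ?D" "?D \<le> 2" "?L w \<le> ?D"
      using gap_bounds[of w] gap_bounds[of "s - w"] w by auto
    have sq: "(next_width s w)\<^sup>2 = s\<^sup>2 + d"
      unfolding next_width_gap d_def by (simp add: power2_eq_square algebra_simps)
    have d0: "0 \<le> d" unfolding d_def using D(1) s by simp
    have "2 * s * ?L w \<le> 2 * s * ?D" using D(3) s by (intro mult_left_mono) auto
    also have "\<dots> \<le> d" unfolding d_def using D(1) s by (intro mult_right_mono) auto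
    finally have d_ge: "2 * s * ?L w \<le> d" .
    have "d \<le> (2 * s + 2) * ?D" unfolding d_def using D by (intro mult_right_mono) auto
    then have "d\<^sup>2 \<le> ((2 * s + 2) * ?D)\<^sup>2" using d0 by (intro power_mono)
    also have "\<dots> = 4 * (s + 1)\<^sup>2 * ?D\<^sup>2" by (simp add: power2_eq_square algebra_simps)
    also have "\<dots> \<le> 4 * (s + 1)\<^sup>2 * (2 * ?Q w)"
    proof (rule mult_left_mono)
      have "?D\<^sup>2 \<le> 2 * ((gap w)\<^sup>2 + (gap (s - w))\<^sup>2)"
        using sum_squares_bound[of "gap w" "gap (s - w)"] by (simp add: power2_sum)
      also have "2 * ((gap w)\<^sup>2 + (gap (s - w))\<^sup>2) \<le> 2 * ?Q w"
        using gap_bounds[of w] gap_bounds[of "s - w"] w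
        by (intro mult_left_mono add_mono power_mono) auto
      finally show "?D\<^sup>2 \<le> 2 * ?Q w" .
    qed simp
    finally have "d\<^sup>2 \<le> 4 * (s + 1)\<^sup>2 * (2 * ?Q w)" .
    moreover have "4 * A * (2 * B) = 8 * A * B" for A B :: real by simp
    ultimately have d2: "d\<^sup>2 \<le> 8 * (s + 1)\<^sup>2 * ?Q w" by (simp only:)
    \<comment> \<open>The cross term \<open>- 2 d l\<close> is dropped, as \<open>d\<close> and
      \<open>l\<close> are both nonnegative.\<close>
    have dl: "(d - l)\<^sup>2 \<le> d\<^sup>2 + l\<^sup>2" using d0 assms(2) by (simp add: power2_diff)
    have "neg_sq (z + (d - l)) \<le> neg_sq z - m * (d - l) + (d - l)\<^sup>2"
      using neg_sq_add[of z "d - l"] by (simp add: m_def)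
    also have "\<dots> \<le> neg_sq z - m * (2 * s * ?L w - l) + (d - l)\<^sup>2"
      using mult_left_mono[OF d_ge m] by (simp add: right_diff_distrib)
    also have "\<dots> \<le> ?B w" using d2 dl by (simp add: algebra_simps)
    finally show "neg_sq ((next_width s w)\<^sup>2 - (a + l)) \<le> ?B w"
      by (simp add: sq z_def algebra_simps)
  qed
  also have "\<dots> \<le> ennreal (s * (neg_sq z + 36 * s + l\<^sup>2))"
  proof (rule ennreal_leI)
    have "m * s * l \<le> m * s * (2 * ln (2 * s + 1))" using assms m by (intro mult_left_mono) auto
    moreover have "(8 * (s + 1)\<^sup>2) * J \<le> (8 * (s + 1)\<^sup>2) * 2" using J_le by (intro mult_left_mono) auto
    \<comment> \<open>Since \<open>s \<ge> 2\<close>, one has \<open>s + 1 \<le> 3 s / 2\<close>,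
      and \<open>16 * 9 / 4 = 36\<close>.\<close>
    moreover have "16 * (s + 1)\<^sup>2 \<le> 36 * s\<^sup>2"
    proof -
      have "(s + 1)\<^sup>2 \<le> (3 / 2 * s)\<^sup>2" using assms by (intro power_mono) auto
      then show ?thesis by (simp add: power_mult_distrib power_divide)
    qed
    ultimately show "?c * (s - 0) - (2 * m * s) * ln (2 * s + 1) + (8 * (s + 1)\<^sup>2) * J \<le> s * (neg_sq z + 36 * s + l\<^sup>2)"
      by (simp add: algebra_simps power2_eq_square)
  qed
  finally show ?thesis by (simp add: z_def)
qed

section \<open>Logarithmic estimates for the drift\<close>

text \<open>
  The lower bound \<open>ln (k + 1)\<close> for the drift of the squared width, summed and lowered slightly so that it
  has a closed form.
\<close>

definition compensator :: "nat \<Rightarrow> real" where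
  "compensator k = real k * ln (real k) - real k"

text \<open>The increment is \<open>ln (k + 1) + k ln ((k + 1) / k) - 1\<close>, whose middle term
  lies between \<open>k / (k + 1)\<close> and 1 by the tangent bound for \<open>ln\<close>. The
  squared bound uses \<open>ln (k + 1) = 2 ln (sqrt (k + 1)) \<le> 2 sqrt k\<close>.\<close>

lemma compensator_increment:
  assumes "1 \<le> k"
  shows "0 \<le> compensator (Suc k) - compensator k"
    and "compensator (Suc k) - compensator k \<le> ln (real k + 1)"
    and "(compensator (Suc k) - compensator k)\<^sup>2 \<le> 4 * real k"
proof -
  let ?x = "real k"
  have x: "1 \<le> ?x" using assms by simp
  have e: "compensator (Suc k) - compensator k = ln (?x + 1) + ?x * (ln (?x + 1) - ln ?x) - 1"
    by (simp add: compensator_def algebra_simps)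
  have q: "ln (?x + 1) - ln ?x = ln ((?x + 1) / ?x)" using x by (simp add: ln_div)
  have "ln ((?x + 1) / ?x) \<le> (?x + 1) / ?x - 1" using x by (intro ln_le_minus_one) simp
  then have "?x * (ln (?x + 1) - ln ?x) \<le> ?x * ((?x + 1) / ?x - 1)"
    unfolding q using x by (intro mult_left_mono) auto
  also have "\<dots> = 1" using x by (simp add: field_simps)
  finally show le: "compensator (Suc k) - compensator k \<le> ln (?x + 1)" unfolding e by linarith
  have "ln (?x / (?x + 1)) \<le> ?x / (?x + 1) - 1" using x by (intro ln_le_minus_one) simp
  then have "1 / (?x + 1) \<le> ln (?x + 1) - ln ?x" using x by (simp add: ln_div field_simps)
  then have "?x * (1 / (?x + 1)) \<le> ?x * (ln (?x + 1) - ln ?x)" using x by (intro mult_left_mono) auto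
  moreover have "ln 2 \<le> ln (?x + 1)" using x by simp
  moreover have "1 / (?x + 1) \<le> 1 / 2" using x by simp
  moreover have "?x * (1 / (?x + 1)) = 1 - 1 / (?x + 1)" using x by (simp add: field_simps)
  ultimately show ge: "0 \<le> compensator (Suc k) - compensator k"
    unfolding e using ln2_ge_two_thirds by linarith
  have "ln (?x + 1) = 2 * ln (sqrt (?x + 1))" using x by (simp add: ln_sqrt)
  also have "\<dots> \<le> 2 * (sqrt (?x + 1) - 1)" using x by (intro mult_left_mono ln_le_minus_one) auto
  also have "\<dots> \<le> 2 * sqrt ?x"
  proof -
    have "sqrt (?x + 1) \<le> sqrt ?x + 1"
      using x by (intro real_le_lsqrt) (auto simp: power2_sum)
    then show ?thesis by simp
  qed
  finally have "compensator (Suc k) - compensator k \<le> 2 * sqrt ?x" using le by linarith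
  then have "(compensator (Suc k) - compensator k)\<^sup>2 \<le> (2 * sqrt ?x)\<^sup>2"
    using ge by (intro power_mono)
  then show "(compensator (Suc k) - compensator k)\<^sup>2 \<le> 4 * ?x" by (simp add: power_mult_distrib)
qed

text \<open>Used in place of Jensen's inequality for \<open>ln\<close>, with \<open>K\<close> an upper bound for the mean of \<open>y\<close>.\<close>

lemma ln_le_tangent:
  fixes y K :: real
  assumes "0 < y" "0 < K"
  shows "ln y \<le> y / K - 1 + ln K"
  using ln_le_minus_one[of "y / K"] assms by (simp add: ln_div)

text \<open>
  The a priori bound \<open>W \<le> 2 k\<close> yields \<open>y (2 ln (4 y + 1) + 8)\<close> for the mean squared width at time \<open>y\<close>;
  inserting it into the logarithm improves \<open>2 ln y\<close> to \<open>ln y + O(ln ln y)\<close>.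
\<close>

definition drift_bound :: "real \<Rightarrow> real" where
  "drift_bound y = ln (8 * (y * (2 * ln (4 * y + 1) + 8)) + 2) + 8"

text \<open>The difference \<open>drift_bound y - ln y\<close> grows like \<open>ln (ln y)\<close>.
  The 41 collects the constants arising in \<open>expectation_W_square_deviation\<close>.\<close>

lemma drift_bound_asymp:
  "((\<lambda>y. (drift_bound y - ln y + 41) / ln y) \<longlongrightarrow> 0) at_top"
  unfolding drift_bound_def by real_asymp

section \<open>The law of the width chain\<close>

definition width :: "nat \<Rightarrow> (nat \<Rightarrow> real) \<Rightarrow> nat \<Rightarrow> real" where
  "width n x k = sqrt (real n) * (left_end n x k + right_end n x k)"

lemma width_0: "width n x 0 = 0"
  by (simp add: width_def)

lemma width_Suc:
  assumes "n \<ge> 1"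
  shows "width n x (Suc k) = next_width (width n x k) (sqrt (real n) * (right_end n x k - x (Suc k)))"
proof -
  have scale: "sqrt (real n) * sqrt (y\<^sup>2 + 1 / real n) = sqrt ((sqrt (real n) * y)\<^sup>2 + 1)" for y
    using assms by (simp add: real_sqrt_mult[symmetric] distrib_left power_mult_distrib)
  have other: "width n x k - sqrt (real n) * (right_end n x k - x (Suc k)) = sqrt (real n) * (left_end n x k + x (Suc k))"
    by (simp add: width_def algebra_simps)
  have "left_end n x (Suc k) + right_end n x (Suc k) =
      sqrt ((right_end n x k - x (Suc k))\<^sup>2 + 1 / real n) + sqrt ((left_end n x k + x (Suc k))\<^sup>2 + 1 / real n)"
    by simp
  then show ?thesis
    unfolding next_width_def other scale[symmetric] by (simp only: width_def distrib_left)
qed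

lemma feasible_width_bounds:
  assumes "n \<ge> 1" "feasible n x k"
  shows "0 \<le> width n x k" "4 * real k \<le> (width n x k)\<^sup>2" "width n x k \<le> 2 * real k"
proof -
  have "0 \<le> width n x k \<and> 4 * real k \<le> (width n x k)\<^sup>2 \<and> width n x k \<le> 2 * real k"
    using assms(2)
  proof (induction k)
    case (Suc k)
    let ?w = "sqrt (real n) * (right_end n x k - x (Suc k))"
    have IH: "0 \<le> width n x k" "4 * real k \<le> (width n x k)\<^sup>2" "width n x k \<le> 2 * real k"
      using Suc by (auto simp: feasible_def)
    have "- left_end n x k \<le> x (Suc k)" "x (Suc k) \<le> right_end n x k"
      using Suc.prems by (auto simp: feasible_def)
    then have "0 \<le> ?w" "?w \<le> width n x k"
      unfolding width_def by (auto intro!: mult_left_mono)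
    note b = next_width_bounds[OF IH(1) this]
    show ?case unfolding width_Suc[OF assms(1)] using b IH by auto
  qed (simp add: width_0)
  then show "0 \<le> width n x k" "4 * real k \<le> (width n x k)\<^sup>2" "width n x k \<le> 2 * real k" by auto
qed

text \<open>The shifts by \<open>x (Suc j)\<close> cancel in the sum and leave two positive square
  roots. So the length is positive at every sample point and may be divided by.\<close>

lemma ends_add_pos:
  assumes "n \<ge> 1" "k \<ge> 1"
  shows "0 < left_end n x k + right_end n x k"
proof (cases k)
  case (Suc j)
  have "0 < sqrt ((right_end n x j - x (Suc j))\<^sup>2 + 1 / real n)"
    "0 < sqrt ((left_end n x j + x (Suc j))\<^sup>2 + 1 / real n)"
    using assms by (auto intro!: add_nonneg_pos)
  then show ?thesis unfolding Suc left_end.simps right_end.simps by linarith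
qed (use assms in simp)

lemma ends_measurable:
  assumes "\<And>j. 1 \<le> j \<Longrightarrow> j \<le> k \<Longrightarrow> Y j \<in> borel_measurable N"
  shows "(\<lambda>\<omega>. right_end n (\<lambda>j. Y j \<omega>) k) \<in> borel_measurable N"
    "(\<lambda>\<omega>. left_end n (\<lambda>j. Y j \<omega>) k) \<in> borel_measurable N"
proof -
  have "(\<lambda>\<omega>. right_end n (\<lambda>j. Y j \<omega>) k) \<in> borel_measurable N \<and>
    (\<lambda>\<omega>. left_end n (\<lambda>j. Y j \<omega>) k) \<in> borel_measurable N"
    using assms
  proof (induction k)
    case (Suc k)
    then have [measurable]: "(\<lambda>\<omega>. right_end n (\<lambda>j. Y j \<omega>) k) \<in> borel_measurable N"
      "(\<lambda>\<omega>. left_end n (\<lambda>j. Y j \<omega>) k) \<in> borel_measurable N" "Y (Suc k) \<in> borel_measurable N"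
      by auto
    show ?case by simp
  qed simp
  then show "(\<lambda>\<omega>. right_end n (\<lambda>j. Y j \<omega>) k) \<in> borel_measurable N"
    "(\<lambda>\<omega>. left_end n (\<lambda>j. Y j \<omega>) k) \<in> borel_measurable N" by auto
qed

section \<open>Joint law of the interval and the next position\<close>

context constrained_HL
begin

abbreviation R :: "nat \<Rightarrow> 'a \<Rightarrow> real" where
  "R k \<omega> \<equiv> right_end n (\<lambda>j. X j \<omega>) k"

abbreviation L :: "nat \<Rightarrow> 'a \<Rightarrow> real" where
  "L k \<omega> \<equiv> left_end n (\<lambda>j. X j \<omega>) k"

abbreviation W :: "nat \<Rightarrow> 'a \<Rightarrow> real" where
  "W k \<omega> \<equiv> width n (\<lambda>j. X j \<omega>) k"

lemma R_L_measurable [measurable]: "R k \<in> borel_measurable M" "L k \<in> borel_measurable M"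
  by (rule ends_measurable; use X_measurable in simp)+

lemma W_measurable [measurable]: "W k \<in> borel_measurable M"
  unfolding width_def by measurable

lemma positions_measurable:
  "(\<lambda>\<omega>. \<lambda>i\<in>{1..k}. X i \<omega>) \<in> M \<rightarrow>\<^sub>M PiM {1..k} (\<lambda>_. borel)"
  by (rule measurable_restrict) (use X_measurable in simp)

lemma subalgebra_past: "subalgebra M (past M X k)"
proof -
  have "sets (past M X k) \<subseteq> sets M"
    using positions_measurable[of k] unfolding past_def measurable_iff_sets by (rule conjunct2)
  then show ?thesis by (simp add: subalgebra_def past_def)
qed

lemma X_measurable_past:
  assumes "1 \<le> j" "j \<le> k"
  shows "X j \<in> borel_measurable (past M X k)"
proof -
  have "(\<lambda>\<omega>. \<lambda>i\<in>{1..k}. X i \<omega>) \<in> past M X k \<rightarrow>\<^sub>M PiM {1..k} (\<lambda>_. borel)"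
    unfolding past_def by (rule measurable_vimage_algebra1) (auto simp: space_PiM)
  then have "(\<lambda>\<omega>. (\<lambda>i\<in>{1..k}. X i \<omega>) j) \<in> borel_measurable (past M X k)"
    by (rule measurable_compose) (use assms in \<open>intro measurable_component_singleton, simp\<close>)
  then show ?thesis using assms by simp
qed

lemma ends_measurable_past:
  "(\<lambda>\<omega>. (L k \<omega>, R k \<omega>)) \<in> past M X k \<rightarrow>\<^sub>M borel \<Otimes>\<^sub>M borel"
proof -
  have [measurable]: "R k \<in> borel_measurable (past M X k)" "L k \<in> borel_measurable (past M X k)"
    by (rule ends_measurable; use X_measurable_past in simp)+
  show ?thesis by measurable
qed

text \<open>The conditional uniform density as a function on the product space, so that the joint
  law can be written as a density against \<open>M \<Otimes>\<^sub>M lborel\<close>.\<close>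

definition kernel_density :: "nat \<Rightarrow> 'a \<times> real \<Rightarrow> ennreal" where
  "kernel_density k = (\<lambda>(\<omega>, y). ennreal (1 / (L k \<omega> + R k \<omega>)) * indicator {- L k \<omega> .. R k \<omega>} y)"

lemma kernel_density_measurable [measurable]:
  "kernel_density k \<in> borel_measurable (M \<Otimes>\<^sub>M lborel)"
proof -
  have "kernel_density k = (\<lambda>p. ennreal (1 / (L k (fst p) + R k (fst p))) *
      (if - L k (fst p) \<le> snd p \<and> snd p \<le> R k (fst p) then 1 else 0))"
    by (auto simp: kernel_density_def fun_eq_iff indicator_def)
  then show ?thesis by simp
qed

text \<open>The event \<open>C\<close> that the interval data lie in \<open>B\<close> belongs to the
  past. On it, conditional expectation replaces the indicator of \<open>X (Suc k) \<in> A\<close> by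
  the uniform probability of \<open>A\<close>, which is the integral of the density.\<close>

lemma joint_law_rectangle:
  assumes k: "1 \<le> k" and B: "B \<in> sets (borel \<Otimes>\<^sub>M borel)" and A: "A \<in> sets borel"
  shows "emeasure M {\<omega> \<in> space M. (L k \<omega>, R k \<omega>) \<in> B \<and> X (Suc k) \<omega> \<in> A} =
    (\<integral>\<^sup>+\<omega>. indicator B (L k \<omega>, R k \<omega>) * (\<integral>\<^sup>+y. kernel_density k (\<omega>, y) * indicator A y \<partial>lborel) \<partial>M)"
proof -
  have [measurable]: "X (Suc k) \<in> borel_measurable M" using X_measurable by simp
  note [measurable] = A B
  interpret F: finite_measure_subalgebra M "past M X k"
    by unfold_locales (rule subalgebra_past)
  define C where "C = (\<lambda>\<omega>. (L k \<omega>, R k \<omega>)) -` B \<inter> space M"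
  have "C = (\<lambda>\<omega>. (L k \<omega>, R k \<omega>)) -` B \<inter> space (past M X k)"
    by (simp add: C_def past_def)
  then have C: "C \<in> sets (past M X k)"
    using measurable_sets[OF ends_measurable_past B] by simp
  have CM [measurable]: "C \<in> sets M" unfolding C_def by measurable
  define g where "g = real_cond_exp M (past M X k) (indicat_real (X (Suc k) -` A \<inter> space M))"
  have int: "integrable M (indicat_real (X (Suc k) -` A \<inter> space M))"
    by (intro integrable_real_indicator) (auto simp: emeasure_eq_measure)
  have gint: "integrable M g" unfolding g_def by (rule F.real_cond_exp_int(1)[OF int])
  define q where "q \<omega> = measure lborel ({- L k \<omega> .. R k \<omega>} \<inter> A) / (L k \<omega> + R k \<omega>)" for \<omega>
  have pos: "0 < L k \<omega> + R k \<omega>" for \<omega> using ends_add_pos[OF n_ge_1 k] .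
  have gq: "AE \<omega> in M. g \<omega> = q \<omega>"
    using X_Suc_cond_uniform[OF k A]
  proof eventually_elim
    case (elim \<omega>)
    have "- L k \<omega> \<le> R k \<omega>" using pos[of \<omega>] by simp
    then have "emeasure lborel {- L k \<omega> .. R k \<omega>} = ennreal (L k \<omega> + R k \<omega>)"
      by (simp add: add.commute)
    then have "measure (uniform_measure lborel {- L k \<omega> .. R k \<omega>}) A
        = measure lborel ({- L k \<omega> .. R k \<omega>} \<inter> A) / measure lborel {- L k \<omega> .. R k \<omega>}"
      using pos[of \<omega>] A by (intro measure_uniform_measure) auto
    also have "measure lborel {- L k \<omega> .. R k \<omega>} = L k \<omega> + R k \<omega>"
      using pos[of \<omega>] by simp
    finally show ?case using elim by (simp add: g_def q_def)
  qed
  have inner: "(\<integral>\<^sup>+y. kernel_density k (\<omega>, y) * indicator A y \<partial>lborel) = ennreal (q \<omega>)" for \<omega>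
  proof -
    have "(\<integral>\<^sup>+y. kernel_density k (\<omega>, y) * indicator A y \<partial>lborel) =
        (\<integral>\<^sup>+y. ennreal (1 / (L k \<omega> + R k \<omega>)) * indicator ({- L k \<omega> .. R k \<omega>} \<inter> A) y \<partial>lborel)"
      by (intro nn_integral_cong) (auto simp: kernel_density_def indicator_def)
    also have "\<dots> = ennreal (1 / (L k \<omega> + R k \<omega>)) * emeasure lborel ({- L k \<omega> .. R k \<omega>} \<inter> A)"
      by (rule nn_integral_cmult_indicator) simp
    also have "emeasure lborel ({- L k \<omega> .. R k \<omega>} \<inter> A) = ennreal (measure lborel ({- L k \<omega> .. R k \<omega>} \<inter> A))"
    proof (rule emeasure_eq_ennreal_measure)
      have "emeasure lborel ({- L k \<omega> .. R k \<omega>} \<inter> A) \<le> emeasure lborel {- L k \<omega> .. R k \<omega>}"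
        by (intro emeasure_mono) auto
      then show "emeasure lborel ({- L k \<omega> .. R k \<omega>} \<inter> A) \<noteq> top"
        using pos[of \<omega>] by (auto simp: top_unique)
    qed
    finally show ?thesis using pos[of \<omega>] by (simp add: q_def ennreal_mult[symmetric])
  qed
  have "{\<omega> \<in> space M. (L k \<omega>, R k \<omega>) \<in> B \<and> X (Suc k) \<omega> \<in> A} = C \<inter> (X (Suc k) -` A \<inter> space M)"
    by (auto simp: C_def)
  then have "emeasure M {\<omega> \<in> space M. (L k \<omega>, R k \<omega>) \<in> B \<and> X (Suc k) \<omega> \<in> A}
      = ennreal (\<integral>\<omega>. indicator C \<omega> * indicat_real (X (Suc k) -` A \<inter> space M) \<omega> \<partial>M)"
    by (simp add: emeasure_eq_measure indicator_inter_arith[symmetric])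
  also have "(\<integral>\<omega>. indicator C \<omega> * indicat_real (X (Suc k) -` A \<inter> space M) \<omega> \<partial>M) = (\<integral>\<omega>. indicator C \<omega> * g \<omega> \<partial>M)"
    using F.real_cond_exp_intA[OF int C] unfolding g_def set_lebesgue_integral_def by simp
  also have "ennreal \<dots> = (\<integral>\<^sup>+\<omega>. ennreal (indicator C \<omega> * g \<omega>) \<partial>M)"
  proof (rule nn_integral_eq_integral[symmetric])
    show "integrable M (\<lambda>\<omega>. indicator C \<omega> * g \<omega>)"
      using integrable_mult_indicator[OF CM gint] by simp
    show "AE \<omega> in M. 0 \<le> indicator C \<omega> * g \<omega>"
      using gq
    proof eventually_elim
      case (elim \<omega>)
      have "0 \<le> q \<omega>" using pos[of \<omega>] by (simp add: q_def)
      then show ?case using elim by simp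
    qed
  qed
  also have "\<dots> = (\<integral>\<^sup>+\<omega>. indicator B (L k \<omega>, R k \<omega>) * ennreal (q \<omega>) \<partial>M)"
  proof (rule nn_integral_cong_AE)
    show "AE \<omega> in M. ennreal (indicator C \<omega> * g \<omega>) = indicator B (L k \<omega>, R k \<omega>) * ennreal (q \<omega>)"
      using gq AE_space by eventually_elim (auto simp: C_def indicator_def)
  qed
  finally show ?thesis unfolding inner .
qed

text \<open>The true law \<mu> and the law \<nu> built from the kernel agree on rectangles. These
  form an intersection-stable generator, so the two measures coincide.\<close>

lemma joint_law:
  assumes k: "1 \<le> k" and f: "f \<in> borel_measurable ((borel \<Otimes>\<^sub>M borel) \<Otimes>\<^sub>M borel)"
  shows "(\<integral>\<^sup>+\<omega>. f ((L k \<omega>, R k \<omega>), X (Suc k) \<omega>) \<partial>M) =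
    (\<integral>\<^sup>+\<omega>. (\<integral>\<^sup>+y. kernel_density k (\<omega>, y) * f ((L k \<omega>, R k \<omega>), y) \<partial>lborel) \<partial>M)"
proof -
  let ?S = "(borel \<Otimes>\<^sub>M borel) \<Otimes>\<^sub>M borel :: ((real \<times> real) \<times> real) measure"
  have [measurable]: "X (Suc k) \<in> borel_measurable M" using X_measurable by simp
  note [measurable] = f
  define \<mu> where "\<mu> = distr M ?S (\<lambda>\<omega>. ((L k \<omega>, R k \<omega>), X (Suc k) \<omega>))"
  define \<nu> where "\<nu> = distr (density (M \<Otimes>\<^sub>M lborel) (kernel_density k)) ?S (\<lambda>p. ((L k (fst p), R k (fst p)), snd p))"
  have nu: "(\<integral>\<^sup>+p. h p \<partial>\<nu>) = (\<integral>\<^sup>+\<omega>. (\<integral>\<^sup>+y. kernel_density k (\<omega>, y) * h ((L k \<omega>, R k \<omega>), y) \<partial>lborel) \<partial>M)"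
    if [measurable]: "h \<in> borel_measurable ?S" for h
    unfolding \<nu>_def by (simp add: nn_integral_distr nn_integral_density lborel.nn_integral_fst[symmetric])
  have rect: "emeasure \<mu> (B \<times> A) = emeasure \<nu> (B \<times> A)"
    if [measurable]: "B \<in> sets (borel \<Otimes>\<^sub>M borel)" "A \<in> sets borel" for A B
  proof -
    have "emeasure \<mu> (B \<times> A) = emeasure M {\<omega> \<in> space M. (L k \<omega>, R k \<omega>) \<in> B \<and> X (Suc k) \<omega> \<in> A}"
      unfolding \<mu>_def by (subst emeasure_distr) (auto intro!: arg_cong[where f="emeasure M"])
    also have "\<dots> = (\<integral>\<^sup>+\<omega>. indicator B (L k \<omega>, R k \<omega>) * (\<integral>\<^sup>+y. kernel_density k (\<omega>, y) * indicator A y \<partial>lborel) \<partial>M)"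
      by (rule joint_law_rectangle[OF k]) fact+
    also have "\<dots> = (\<integral>\<^sup>+p. indicator (B \<times> A) p \<partial>\<nu>)"
    proof (subst nu)
      show "(\<integral>\<^sup>+\<omega>. indicator B (L k \<omega>, R k \<omega>) * (\<integral>\<^sup>+y. kernel_density k (\<omega>, y) * indicator A y \<partial>lborel) \<partial>M)
        = (\<integral>\<^sup>+\<omega>. (\<integral>\<^sup>+y. kernel_density k (\<omega>, y) * indicator (B \<times> A) ((L k \<omega>, R k \<omega>), y) \<partial>lborel) \<partial>M)"
        by (intro nn_integral_cong) (auto simp: indicator_def intro!: nn_integral_cong)
    qed simp
    also have "\<dots> = emeasure \<nu> (B \<times> A)"
      by (rule nn_integral_indicator) (simp add: \<nu>_def)
    finally show ?thesis .
  qed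
  have "\<mu> = \<nu>"
  proof (rule measure_eqI_generator_eq)
    let ?E = "{a \<times> b | a b. a \<in> sets (borel \<Otimes>\<^sub>M borel :: (real \<times> real) measure) \<and> b \<in> sets (borel :: real measure)}"
    have UNIV2: "UNIV \<in> sets (borel \<Otimes>\<^sub>M borel :: (real \<times> real) measure)"
      using sets.top[of "borel \<Otimes>\<^sub>M borel :: (real \<times> real) measure"] by (simp add: space_pair_measure)
    show "Int_stable ?E" by (rule Int_stable_pair_measure_generator)
    show "?E \<subseteq> Pow (space ?S)" by (auto simp: space_pair_measure)
    show "emeasure \<mu> Z = emeasure \<nu> Z" if "Z \<in> ?E" for Z using that rect by auto
    show "sets \<mu> = sigma_sets (space ?S) ?E" "sets \<nu> = sigma_sets (space ?S) ?E"
      by (simp_all add: \<mu>_def \<nu>_def sets_pair_measure space_pair_measure)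
    show "range (\<lambda>_::nat. UNIV \<times> UNIV) \<subseteq> ?E" using UNIV2 by (auto intro!: exI[of _ UNIV])
    show "(\<Union>i::nat. UNIV \<times> UNIV) = space ?S" by (simp add: space_pair_measure)
    show "emeasure \<mu> (UNIV \<times> UNIV) \<noteq> \<infinity>" for i :: nat
      using sets.top[of ?S] unfolding \<mu>_def
      by (subst emeasure_distr) (auto simp: emeasure_eq_measure space_pair_measure)
  qed
  then have "(\<integral>\<^sup>+p. f p \<partial>\<mu>) = (\<integral>\<^sup>+p. f p \<partial>\<nu>)" by simp
  then show ?thesis by (simp add: nu f) (simp add: \<mu>_def nn_integral_distr)
qed

text \<open>The joint law is applied to the indicator of leaving the interval, on which the kernel
  density vanishes.\<close>

lemma AE_X_in_interval:
  assumes k: "1 \<le> k"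
  shows "AE \<omega> in M. - L k \<omega> \<le> X (Suc k) \<omega> \<and> X (Suc k) \<omega> \<le> R k \<omega>"
proof -
  have [measurable]: "X (Suc k) \<in> borel_measurable M" using X_measurable by simp
  let ?f = "\<lambda>p :: (real \<times> real) \<times> real. if - fst (fst p) \<le> snd p \<and> snd p \<le> snd (fst p) then 0 else 1 :: ennreal"
  have "(\<integral>\<^sup>+\<omega>. ?f ((L k \<omega>, R k \<omega>), X (Suc k) \<omega>) \<partial>M) =
    (\<integral>\<^sup>+\<omega>. (\<integral>\<^sup>+y. kernel_density k (\<omega>, y) * ?f ((L k \<omega>, R k \<omega>), y) \<partial>lborel) \<partial>M)"
    by (rule joint_law[OF k]) measurable
  also have "\<dots> = (\<integral>\<^sup>+\<omega>. (\<integral>\<^sup>+y. 0 \<partial>(lborel :: real measure)) \<partial>M)"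
    by (intro nn_integral_cong) (auto simp: kernel_density_def)
  finally have "(\<integral>\<^sup>+\<omega>. ?f ((L k \<omega>, R k \<omega>), X (Suc k) \<omega>) \<partial>M) = 0" by simp
  then have "AE \<omega> in M. ?f ((L k \<omega>, R k \<omega>), X (Suc k) \<omega>) = 0"
    by (subst (asm) nn_integral_0_iff_AE) measurable
  then show ?thesis by eventually_elim (auto split: if_splits)
qed

lemma AE_feasible: "AE \<omega> in M. feasible n (\<lambda>j. X j \<omega>) k"
proof -
  have "AE \<omega> in M. \<forall>j. - L j \<omega> \<le> X (Suc j) \<omega> \<and> X (Suc j) \<omega> \<le> R j \<omega>"
  proof (rule AE_all_countable[THEN iffD2], rule allI)
    fix j
    show "AE \<omega> in M. - L j \<omega> \<le> X (Suc j) \<omega> \<and> X (Suc j) \<omega> \<le> R j \<omega>"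
    proof (cases "j = 0")
      case True
      then show ?thesis using X_1 by (intro AE_I2) simp
    qed (use AE_X_in_interval in simp)
  qed
  then show ?thesis by eventually_elim (simp add: feasible_def)
qed

text \<open>The premise says that the mean of \<open>h\<close> after one step from width
  \<open>s\<close> is at most \<open>u s\<close>. It is required only for widths in the range that
  holds almost surely.\<close>

lemma next_step_bound:
  assumes k: "1 \<le> k" and [measurable]: "h \<in> borel_measurable borel"
    and le: "\<And>s. 0 < s \<Longrightarrow> 4 * real k \<le> s\<^sup>2 \<Longrightarrow> s \<le> 2 * real k \<Longrightarrow>
      (\<integral>\<^sup>+w. ennreal (h (next_width s w)) * indicator {0..s} w \<partial>lborel) \<le> ennreal (s * u s)"
  shows "(\<integral>\<^sup>+\<omega>. ennreal (h (W (Suc k) \<omega>)) \<partial>M) \<le> (\<integral>\<^sup>+\<omega>. ennreal (u (W k \<omega>)) \<partial>M)"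
proof -
  have [measurable]: "X (Suc k) \<in> borel_measurable M" using X_measurable by simp
  let ?r = "sqrt (real n)"
  have r: "0 < ?r" using n_ge_1 by simp
  let ?f = "\<lambda>p :: (real \<times> real) \<times> real. ennreal (h (next_width (?r * (fst (fst p) + snd (fst p))) (?r * (snd (fst p) - snd p))))"
  have [measurable]: "(\<lambda>p. next_width (fst p) (snd p)) \<in> borel_measurable (borel \<Otimes>\<^sub>M borel)"
    unfolding next_width_def by measurable
  have "(\<lambda>p :: (real \<times> real) \<times> real. (\<lambda>q. next_width (fst q) (snd q)) (?r * (fst (fst p) + snd (fst p)), ?r * (snd (fst p) - snd p)))
      \<in> borel_measurable ((borel \<Otimes>\<^sub>M borel) \<Otimes>\<^sub>M borel)"
    by measurable
  then have [measurable]: "?f \<in> borel_measurable ((borel \<Otimes>\<^sub>M borel) \<Otimes>\<^sub>M borel)"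
    by simp
  have "(\<integral>\<^sup>+\<omega>. ennreal (h (W (Suc k) \<omega>)) \<partial>M) = (\<integral>\<^sup>+\<omega>. ?f ((L k \<omega>, R k \<omega>), X (Suc k) \<omega>) \<partial>M)"
    by (simp add: width_Suc[OF n_ge_1]) (simp add: width_def)
  also have "\<dots> = (\<integral>\<^sup>+\<omega>. (\<integral>\<^sup>+y. kernel_density k (\<omega>, y) * ?f ((L k \<omega>, R k \<omega>), y) \<partial>lborel) \<partial>M)"
    by (rule joint_law[OF k]) measurable
  also have "\<dots> \<le> (\<integral>\<^sup>+\<omega>. ennreal (u (W k \<omega>)) \<partial>M)"
  proof (rule nn_integral_mono_AE)
    show "AE \<omega> in M. (\<integral>\<^sup>+y. kernel_density k (\<omega>, y) * ?f ((L k \<omega>, R k \<omega>), y) \<partial>lborel) \<le> ennreal (u (W k \<omega>))"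
      using AE_feasible[of k]
    proof eventually_elim
      case (elim \<omega>)
      define s where "s = W k \<omega>"
      have pos: "0 < L k \<omega> + R k \<omega>" using ends_add_pos[OF n_ge_1 k] .
      have s: "s = ?r * (L k \<omega> + R k \<omega>)" by (simp add: s_def width_def)
      have s_pos: "0 < s" unfolding s using r pos by simp
      let ?G = "\<lambda>w. ennreal (h (next_width s w)) * indicator {0..s} w"
      have [measurable]: "(\<lambda>w. next_width s w) \<in> borel_measurable borel" unfolding next_width_def by measurable
      have ind: "indicator {0..s} (?r * R k \<omega> + (- ?r) * y) = (indicator {- L k \<omega> .. R k \<omega>} y :: ennreal)" for y
      proof -
        have "0 \<le> ?r * R k \<omega> + (- ?r) * y \<longleftrightarrow> ?r * y \<le> ?r * R k \<omega>" by simp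
        then have "0 \<le> ?r * R k \<omega> + (- ?r) * y \<longleftrightarrow> y \<le> R k \<omega>"
          unfolding mult_le_cancel_left_pos[OF r] .
        moreover have "?r * R k \<omega> + (- ?r) * y \<le> s \<longleftrightarrow> ?r * (- L k \<omega>) \<le> ?r * y"
          unfolding s by (auto simp: algebra_simps)
        then have "?r * R k \<omega> + (- ?r) * y \<le> s \<longleftrightarrow> - L k \<omega> \<le> y"
          unfolding mult_le_cancel_left_pos[OF r] .
        ultimately show ?thesis by (simp add: indicator_def conj_commute)
      qed
      have integrand: "kernel_density k (\<omega>, y) * ?f ((L k \<omega>, R k \<omega>), y) =
          ennreal (1 / (L k \<omega> + R k \<omega>)) * ?G (?r * R k \<omega> + (- ?r) * y)" for y
        unfolding ind by (simp add: kernel_density_def s[symmetric] mult_ac right_diff_distrib)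
      \<comment> \<open>The factor \<open>sqrt n\<close> is carried along for the substitution
        \<open>w = sqrt n (R - y)\<close>, which absorbs it. It reappears from
        \<open>s / (L + R)\<close> and cancels at the end.\<close>
      have "ennreal ?r * (\<integral>\<^sup>+y. kernel_density k (\<omega>, y) * ?f ((L k \<omega>, R k \<omega>), y) \<partial>lborel)
        = ennreal ?r * (\<integral>\<^sup>+y. ennreal (1 / (L k \<omega> + R k \<omega>)) * ?G (?r * R k \<omega> + (- ?r) * y) \<partial>lborel)"
        unfolding integrand ..
      also have "\<dots> = ennreal (1 / (L k \<omega> + R k \<omega>)) * (ennreal ?r * (\<integral>\<^sup>+y. ?G (?r * R k \<omega> + (- ?r) * y) \<partial>lborel))"
        by (subst nn_integral_cmult) (measurable, simp add: mult_ac)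
      also have "ennreal ?r * (\<integral>\<^sup>+y. ?G (?r * R k \<omega> + (- ?r) * y) \<partial>lborel) = (\<integral>\<^sup>+w. ?G w \<partial>lborel)"
        using nn_integral_real_affine[of ?G "- ?r" "?r * R k \<omega>"] r by simp
      also have "ennreal (1 / (L k \<omega> + R k \<omega>)) * \<dots> \<le> ennreal (1 / (L k \<omega> + R k \<omega>)) * ennreal (s * u s)"
        using feasible_width_bounds[OF n_ge_1 elim] s_pos
        by (intro mult_left_mono le) (auto simp: s_def)
      also have "\<dots> = ennreal ?r * ennreal (u s)"
        using pos r by (simp add: ennreal_mult'[symmetric] s)
      finally show ?case
        using r by (simp add: ennreal_mult_le_mult_iff s_def)
    qed
  qed
  finally show ?thesis .
qed

end

section \<open>Moments of the width chain\<close>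

context constrained_HL
begin

lemma AE_W_bounds: "AE \<omega> in M. 0 \<le> W k \<omega> \<and> 4 * real k \<le> (W k \<omega>)\<^sup>2 \<and> W k \<omega> \<le> 2 * real k"
  using AE_feasible[of k] by eventually_elim (use feasible_width_bounds[OF n_ge_1] in auto)

lemma W_nonneg: "0 \<le> W k \<omega>"
proof (cases "k = 0")
  case False
  then show ?thesis
    using ends_add_pos[OF n_ge_1, of k "\<lambda>j. X j \<omega>"] by (simp add: width_def)
qed (simp add: width_0)

lemma integrable_W:
  fixes f :: "real \<Rightarrow> real"
  assumes "continuous_on {0..} f"
  shows "integrable M (\<lambda>\<omega>. f (W k \<omega>))"
proof -
  have c: "continuous_on {0..2 * real k} f" using assms by (rule continuous_on_subset) auto
  have "compact (f ` {0..2 * real k})" by (rule compact_continuous_image[OF c]) simp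
  then obtain B where B: "\<And>s. s \<in> {0..2 * real k} \<Longrightarrow> norm (f s) \<le> B"
    using compact_imp_bounded bounded_iff by (metis imageI)
  \<comment> \<open>Clamping at 0 extends \<open>f\<close> continuously to the whole line, which
    gives measurability; as \<open>W\<close> is nonnegative, nothing changes.\<close>
  have g: "continuous_on UNIV (\<lambda>s. f (max 0 s))"
    by (rule continuous_on_compose2[OF assms]) (auto intro!: continuous_intros)
  have [measurable]: "(\<lambda>s. f (max 0 s)) \<in> borel_measurable borel"
    by (rule borel_measurable_continuous_onI[OF g])
  have "integrable M (\<lambda>\<omega>. f (max 0 (W k \<omega>)))"
  proof (rule integrable_const_bound)
    show "AE \<omega> in M. norm (f (max 0 (W k \<omega>))) \<le> B"
      using AE_W_bounds[of k] by eventually_elim (intro B, auto)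
    show "(\<lambda>\<omega>. f (max 0 (W k \<omega>))) \<in> borel_measurable M"
      by (rule measurable_compose[OF W_measurable]) measurable
  qed
  then show ?thesis using W_nonneg by (simp add: max_absorb2)
qed

lemma expectation_next_step:
  assumes k: "1 \<le> k" and h: "continuous_on UNIV h" "\<And>s. 0 \<le> h s"
    and u: "continuous_on {0..} u" "\<And>s. 0 \<le> s \<Longrightarrow> 0 \<le> u s"
    and le: "\<And>s. 0 < s \<Longrightarrow> 4 * real k \<le> s\<^sup>2 \<Longrightarrow> s \<le> 2 * real k \<Longrightarrow>
      (\<integral>\<^sup>+w. ennreal (h (next_width s w)) * indicator {0..s} w \<partial>lborel) \<le> ennreal (s * u s)"
  shows "expectation (\<lambda>\<omega>. h (W (Suc k) \<omega>)) \<le> expectation (\<lambda>\<omega>. u (W k \<omega>))"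
proof -
  have hm: "h \<in> borel_measurable borel" by (rule borel_measurable_continuous_onI[OF h(1)])
  have ih: "integrable M (\<lambda>\<omega>. h (W (Suc k) \<omega>))"
    by (rule integrable_W[OF continuous_on_subset[OF h(1)]]) simp
  have iu: "integrable M (\<lambda>\<omega>. u (W k \<omega>))" by (rule integrable_W[OF u(1)])
  have pu: "AE \<omega> in M. 0 \<le> u (W k \<omega>)"
    using AE_W_bounds[of k] by eventually_elim (simp add: u(2))
  have "ennreal (expectation (\<lambda>\<omega>. h (W (Suc k) \<omega>))) = (\<integral>\<^sup>+\<omega>. ennreal (h (W (Suc k) \<omega>)) \<partial>M)"
    by (rule nn_integral_eq_integral[OF ih, symmetric]) (simp add: h(2))
  also have "\<dots> \<le> (\<integral>\<^sup>+\<omega>. ennreal (u (W k \<omega>)) \<partial>M)" by (rule next_step_bound[OF k hm le])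
  also have "\<dots> = ennreal (expectation (\<lambda>\<omega>. u (W k \<omega>)))" by (rule nn_integral_eq_integral[OF iu pu])
  finally show ?thesis using integral_nonneg_AE[OF pu] by simp
qed

lemma expectation_W_square_Suc:
  assumes "1 \<le> k"
  shows "expectation (\<lambda>\<omega>. (W (Suc k) \<omega>)\<^sup>2) \<le>
    expectation (\<lambda>\<omega>. (W k \<omega>)\<^sup>2) + expectation (\<lambda>\<omega>. 2 * ln (2 * W k \<omega> + 1)) + 8"
proof -
  have c: "continuous_on {0..} (\<lambda>s::real. 2 * ln (2 * s + 1))"
    by (intro continuous_intros) auto
  have i: "integrable M (\<lambda>\<omega>. (W k \<omega>)\<^sup>2)" "integrable M (\<lambda>\<omega>. 2 * ln (2 * W k \<omega> + 1))"
    by (rule integrable_W[OF c] integrable_W[of "\<lambda>s. s\<^sup>2"], (intro continuous_intros)?)+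
  have "expectation (\<lambda>\<omega>. (W (Suc k) \<omega>)\<^sup>2) \<le>
      expectation (\<lambda>\<omega>. (W k \<omega>)\<^sup>2 + 2 * ln (2 * W k \<omega> + 1) + 8)"
    by (rule expectation_next_step[OF assms, where u="\<lambda>s. s\<^sup>2 + 2 * ln (2 * s + 1) + 8" and h="\<lambda>s. s\<^sup>2"])
      (auto intro!: continuous_intros nn_integral_next_width_square c)
  also have "\<dots> = expectation (\<lambda>\<omega>. (W k \<omega>)\<^sup>2) + expectation (\<lambda>\<omega>. 2 * ln (2 * W k \<omega> + 1)) + 8"
    using i by (simp add: prob_space)
  finally show ?thesis .
qed

text \<open>Each step adds at most \<open>d + 8\<close>, and the first square is at most 4. It is
  applied twice, with a crude and then with a sharper \<open>d\<close>.\<close>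

lemma expectation_W_square_linear:
  assumes "0 \<le> d" "1 \<le> k"
    and "\<And>j. 1 \<le> j \<Longrightarrow> j < k \<Longrightarrow> expectation (\<lambda>\<omega>. 2 * ln (2 * W j \<omega> + 1)) \<le> d"
  shows "expectation (\<lambda>\<omega>. (W k \<omega>)\<^sup>2) \<le> real k * (d + 8)"
  using assms(2,3)
proof (induction k rule: dec_induct)
  case base
  have "expectation (\<lambda>\<omega>. (W 1 \<omega>)\<^sup>2) \<le> expectation (\<lambda>\<omega>. 4)"
  proof (rule integral_mono_AE)
    show "AE \<omega> in M. (W 1 \<omega>)\<^sup>2 \<le> 4"
      using AE_W_bounds[of 1]
    proof eventually_elim
      case (elim \<omega>)
      then have "(W 1 \<omega>)\<^sup>2 \<le> 2\<^sup>2" by (intro power_mono) auto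
      then show ?case by simp
    qed
  qed (auto intro!: integrable_W continuous_intros)
  then show ?case using assms(1) by (simp add: prob_space)
next
  case (step k)
  have "expectation (\<lambda>\<omega>. (W k \<omega>)\<^sup>2) \<le> real k * (d + 8)"
    using step.IH step.prems by auto
  moreover have "expectation (\<lambda>\<omega>. 2 * ln (2 * W k \<omega> + 1)) \<le> d" using step.prems step.hyps by auto
  ultimately show ?case using expectation_W_square_Suc[of k] step.hyps by (simp add: algebra_simps)
qed

text \<open>The almost sure bound \<open>W j \<le> 2 j\<close> is inserted in the logarithm.\<close>

lemma expectation_W_square_crude:
  assumes "1 \<le> k" "k \<le> K"
  shows "expectation (\<lambda>\<omega>. (W k \<omega>)\<^sup>2) \<le> real K * (2 * ln (4 * real K + 1) + 8)"
proof -
  let ?d = "2 * ln (4 * real K + 1)"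
  have d: "0 \<le> ?d" by simp
  have "expectation (\<lambda>\<omega>. (W k \<omega>)\<^sup>2) \<le> real k * (?d + 8)"
  proof (rule expectation_W_square_linear[OF d assms(1)])
    fix j assume j: "1 \<le> j" "j < k"
    have "expectation (\<lambda>\<omega>. 2 * ln (2 * W j \<omega> + 1)) \<le> expectation (\<lambda>\<omega>. ?d)"
    proof (rule integral_mono_AE)
      show "AE \<omega> in M. 2 * ln (2 * W j \<omega> + 1) \<le> ?d"
        using AE_W_bounds[of j]
      proof eventually_elim
        case (elim \<omega>)
        then have "2 * W j \<omega> + 1 \<le> 4 * real K + 1" using j assms(2) by auto
        then show ?case using elim by simp
      qed
    qed (auto intro!: integrable_W continuous_intros)
    then show "expectation (\<lambda>\<omega>. 2 * ln (2 * W j \<omega> + 1)) \<le> ?d" by (simp add: prob_space)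
  qed
  also have "\<dots> \<le> real K * (?d + 8)" using assms d by (intro mult_right_mono) auto
  finally show ?thesis .
qed

text \<open>The bootstrap: \<open>2 ln (2 W + 1) \<le> ln (8 W\<^sup>2 + 2)\<close>, and the tangent
  of \<open>ln\<close> at \<open>8 B + 2\<close>, with \<open>B\<close> the crude bound for the mean
  of \<open>W\<^sup>2\<close>, bounds the mean of the right side by \<open>ln (8 B + 2)\<close>.
  This halves the leading coefficient.\<close>

lemma expectation_W_square_le:
  assumes "1 \<le> K"
  shows "expectation (\<lambda>\<omega>. (W K \<omega>)\<^sup>2) \<le> real K * drift_bound (real K)"
proof -
  define B where "B = real K * (2 * ln (4 * real K + 1) + 8)"
  have B: "0 \<le> B" unfolding B_def by simp
  have "expectation (\<lambda>\<omega>. (W K \<omega>)\<^sup>2) \<le> real K * (ln (8 * B + 2) + 8)"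
  proof (rule expectation_W_square_linear[OF _ assms])
    fix j assume j: "1 \<le> j" "j < K"
    have i: "integrable M (\<lambda>\<omega>. (W j \<omega>)\<^sup>2)" by (rule integrable_W) (intro continuous_intros)
    have "expectation (\<lambda>\<omega>. 2 * ln (2 * W j \<omega> + 1))
        \<le> expectation (\<lambda>\<omega>. (8 * (W j \<omega>)\<^sup>2 + 2) / (8 * B + 2) - 1 + ln (8 * B + 2))"
    proof (rule integral_mono_AE)
      show "AE \<omega> in M. 2 * ln (2 * W j \<omega> + 1) \<le> (8 * (W j \<omega>)\<^sup>2 + 2) / (8 * B + 2) - 1 + ln (8 * B + 2)"
        using AE_W_bounds[of j]
      proof eventually_elim
        case (elim \<omega>)
        have "2 * ln (2 * W j \<omega> + 1) = ln ((2 * W j \<omega> + 1)\<^sup>2)"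
          using elim by (simp add: ln_realpow)
        also have "\<dots> \<le> ln (8 * (W j \<omega>)\<^sup>2 + 2)"
        proof (rule ln_mono)
          show "(2 * W j \<omega> + 1)\<^sup>2 \<le> 8 * (W j \<omega>)\<^sup>2 + 2"
            \<comment> \<open>The difference of the two sides is
              \<open>(2 W - 1)\<^sup>2\<close>.\<close>
            using zero_le_power2[of "2 * W j \<omega> - 1"] by (simp add: power2_eq_square algebra_simps)
        qed (use elim in \<open>auto intro!: add_nonneg_pos\<close>)
        also have "\<dots> \<le> (8 * (W j \<omega>)\<^sup>2 + 2) / (8 * B + 2) - 1 + ln (8 * B + 2)"
          using B by (intro ln_le_tangent add_nonneg_pos) auto
        finally show ?case .
      qed
    qed (use B in \<open>auto intro!: integrable_W continuous_intros\<close>)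
    also have "\<dots> = (8 * expectation (\<lambda>\<omega>. (W j \<omega>)\<^sup>2) + 2) / (8 * B + 2) - 1 + ln (8 * B + 2)"
      using i by (simp add: prob_space)
    also have "\<dots> \<le> (8 * B + 2) / (8 * B + 2) - 1 + ln (8 * B + 2)"
      using expectation_W_square_crude[of j K] j B
      by (intro add_mono diff_mono divide_right_mono) (auto simp: B_def)
    finally show "expectation (\<lambda>\<omega>. 2 * ln (2 * W j \<omega> + 1)) \<le> ln (8 * B + 2)" using B by simp
  qed (use B in simp)
  then show ?thesis by (simp add: drift_bound_def B_def)
qed

lemma continuous_neg_sq: "continuous_on A (\<lambda>s. neg_sq (s\<^sup>2 - a))"
  unfolding neg_sq_def by (intro continuous_intros)

text \<open>One step adds at most \<open>36 E W + 4 k \<le> 76 k\<close>, by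
  \<open>W \<le> 2 k\<close>, and \<open>38 (k + 1)\<^sup>2 - 38 k\<^sup>2 \<ge> 76 k\<close>. The
  start is 0 because \<open>compensator 1 = -1\<close>.\<close>

lemma expectation_neg_sq_le:
  assumes "1 \<le> k"
  shows "expectation (\<lambda>\<omega>. neg_sq ((W k \<omega>)\<^sup>2 - compensator k)) \<le> 38 * (real k)\<^sup>2"
  using assms
proof (induction k rule: dec_induct)
  case base
  have "neg_sq (s\<^sup>2 - compensator 1) = 0" for s
    using zero_le_power2[of s] by (simp add: neg_sq_def compensator_def min_absorb2)
  then show ?case by simp
next
  case (step k)
  let ?l = "compensator (Suc k) - compensator k"
  note inc = compensator_increment[OF step.hyps(1)]
  have "expectation (\<lambda>\<omega>. neg_sq ((W (Suc k) \<omega>)\<^sup>2 - compensator (Suc k)))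
    \<le> expectation (\<lambda>\<omega>. neg_sq ((W k \<omega>)\<^sup>2 - compensator k) + 36 * W k \<omega> + ?l\<^sup>2)"
  proof (rule expectation_next_step[OF step.hyps(1), where h="\<lambda>s. neg_sq (s\<^sup>2 - compensator (Suc k))"
        and u="\<lambda>s. neg_sq (s\<^sup>2 - compensator k) + 36 * s + ?l\<^sup>2"])
    show "continuous_on {0..} (\<lambda>s. neg_sq (s\<^sup>2 - compensator k) + 36 * s + ?l\<^sup>2)"
      by (intro continuous_intros continuous_neg_sq)
    fix s :: real assume s: "0 < s" "4 * real k \<le> s\<^sup>2"
    have "2\<^sup>2 \<le> s\<^sup>2" using s step.hyps(1) by simp
    then have s2: "2 \<le> s" by (rule power2_le_imp_le) (use s in simp)
    \<comment> \<open>The lower bound on the width makes the drift \<open>2 ln (2 s + 1)\<close>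
      dominate \<open>ln (k + 1)\<close>, hence the compensator increment.\<close>
    have "real k + 1 \<le> (2 * s + 1)\<^sup>2" using s by (simp add: power2_eq_square algebra_simps)
    then have "ln (real k + 1) \<le> ln ((2 * s + 1)\<^sup>2)" by (intro ln_mono) auto
    then have "?l \<le> 2 * ln (2 * s + 1)" using inc(2) s by (simp add: ln_realpow)
    from nn_integral_neg_sq_next_width[OF s2 inc(1) this, of "compensator k"]
    show "(\<integral>\<^sup>+w. ennreal (neg_sq ((next_width s w)\<^sup>2 - compensator (Suc k))) * indicator {0..s} w \<partial>lborel)
      \<le> ennreal (s * (neg_sq (s\<^sup>2 - compensator k) + 36 * s + ?l\<^sup>2))" by simp
  qed (auto simp: neg_sq_def intro!: continuous_intros)
  also have "\<dots> = expectation (\<lambda>\<omega>. neg_sq ((W k \<omega>)\<^sup>2 - compensator k)) + 36 * expectation (W k) + ?l\<^sup>2"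
    using integrable_W[OF continuous_neg_sq, of k "compensator k"] integrable_W[OF continuous_on_id, of k]
    by (simp add: prob_space)
  also have "expectation (W k) \<le> expectation (\<lambda>\<omega>. 2 * real k)"
  proof (rule integral_mono_AE)
    show "AE \<omega> in M. W k \<omega> \<le> 2 * real k" using AE_W_bounds[of k] by eventually_elim simp
  qed (use integrable_W[OF continuous_on_id, of k] in auto)
  finally have "expectation (\<lambda>\<omega>. neg_sq ((W (Suc k) \<omega>)\<^sup>2 - compensator (Suc k)))
    \<le> 38 * (real k)\<^sup>2 + 36 * (2 * real k) + 4 * real k"
    using step.IH inc(3) by (simp add: prob_space)
  also have "\<dots> \<le> 38 * (real (Suc k))\<^sup>2" by (simp add: power2_eq_square algebra_simps)
  finally show ?case .
qed

text \<open>An absolute value is the value plus twice its negative part. So an upper bound for the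
  mean and a second moment of the negative part suffice; they are combined through
  \<open>2 |z| \<le> z\<^sup>2 / k + k\<close>. The other \<open>k\<close> pays for replacing
  \<open>compensator k\<close> by \<open>k ln k\<close>.\<close>

lemma expectation_W_square_deviation:
  assumes "1 \<le> k"
  shows "expectation (\<lambda>\<omega>. \<bar>(W k \<omega>)\<^sup>2 - real k * ln (real k)\<bar>)
    \<le> real k * (drift_bound (real k) - ln (real k) + 41)"
proof -
  let ?k = "real k"
  have k: "0 < ?k" using assms by simp
  let ?Z = "\<lambda>\<omega>. (W k \<omega>)\<^sup>2 - compensator k"
  have i: "integrable M (\<lambda>\<omega>. (W k \<omega>)\<^sup>2)" by (rule integrable_W) (intro continuous_intros)
  note i' = integrable_W[OF continuous_neg_sq, of k "compensator k"]
  have "expectation (\<lambda>\<omega>. \<bar>(W k \<omega>)\<^sup>2 - ?k * ln ?k\<bar>) \<le> expectation (\<lambda>\<omega>. ?Z \<omega> + neg_sq (?Z \<omega>) / ?k + 2 * ?k)"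
  proof (rule integral_mono)
    fix \<omega>
    have "\<bar>z\<bar> \<le> z + neg_sq z / ?k + ?k" for z
    proof (cases "z \<ge> 0")
      case False
      have "0 \<le> (z + ?k)\<^sup>2 / ?k" using k by simp
      also have "\<dots> = z\<^sup>2 / ?k + 2 * z + ?k" using k by (simp add: power2_eq_square field_simps)
      finally show ?thesis using False by (simp add: neg_sq_def)
    qed (use k in \<open>simp add: neg_sq_def\<close>)
    from this[of "?Z \<omega>"]
    show "\<bar>(W k \<omega>)\<^sup>2 - ?k * ln ?k\<bar> \<le> ?Z \<omega> + neg_sq (?Z \<omega>) / ?k + 2 * ?k"
      using k unfolding compensator_def by linarith
  qed (use i i' in auto)
  also have "\<dots> = expectation (\<lambda>\<omega>. (W k \<omega>)\<^sup>2) - compensator k + expectation (\<lambda>\<omega>. neg_sq (?Z \<omega>)) / ?k + 2 * ?k"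
    using i i' by (simp add: prob_space)
  also have "\<dots> \<le> ?k * drift_bound ?k - compensator k + 38 * ?k\<^sup>2 / ?k + 2 * ?k"
    using expectation_W_square_le[OF assms] expectation_neg_sq_le[OF assms] k
    by (intro add_mono diff_mono divide_right_mono) auto
  also have "\<dots> = ?k * (drift_bound ?k - ln ?k + 41)"
    using k by (simp add: compensator_def power2_eq_square algebra_simps)
  finally show ?thesis .
qed

end

section \<open>Convergence of the diameter\<close>

text \<open>Factor the difference of squares; the factor \<open>y / q + 1\<close> is at least 1.
  This passes from squared lengths to lengths.\<close>

lemma abs_sqrt_ratio_le:
  fixes y q :: real
  assumes "0 \<le> y" "0 < q"
  shows "\<bar>y / q - 1\<bar> \<le> \<bar>y\<^sup>2 / q\<^sup>2 - 1\<bar>"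
proof -
  have "y\<^sup>2 / q\<^sup>2 - 1 = (y / q - 1) * (y / q + 1)"
    by (simp add: power_divide[symmetric] power2_eq_square algebra_simps)
  moreover have "\<bar>y / q - 1\<bar> * 1 \<le> \<bar>y / q - 1\<bar> * \<bar>y / q + 1\<bar>"
    using assms by (intro mult_left_mono) (auto simp: abs_of_nonneg)
  ultimately show ?thesis by (simp add: abs_mult)
qed

section \<open>Asymptotics along the integer parts of \<open>n t\<close>\<close>

lemma floor_mult_bounds:
  assumes "0 < t"
  shows "real (nat \<lfloor>real n * t\<rfloor>) \<le> real n * t" "real n * t - 1 \<le> real (nat \<lfloor>real n * t\<rfloor>)"
  using assms by (auto simp: of_nat_nat floor_le_iff intro: of_int_floor_le)

lemma filterlim_floor_mult:
  assumes "0 < t"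
  shows "filterlim (\<lambda>n. real (nat \<lfloor>real n * t\<rfloor>)) at_top sequentially"
proof (rule filterlim_at_top_mono)
  show "filterlim (\<lambda>n. real n * t - 1) at_top sequentially" using assms by real_asymp
qed (use floor_mult_bounds[OF assms] in auto)

lemma floor_mult_ln_asymp:
  assumes "0 < t"
  shows "(\<lambda>n. real (nat \<lfloor>real n * t\<rfloor>) * ln (real (nat \<lfloor>real n * t\<rfloor>)) / (real n * t * ln (real n))) \<longlonglongrightarrow> 1"
proof (rule tendsto_sandwich)
  let ?k = "\<lambda>n. real (nat \<lfloor>real n * t\<rfloor>)"
  show "(\<lambda>n. (real n * t - 1) * ln (real n * t - 1) / (real n * t * ln (real n))) \<longlonglongrightarrow> 1"
    using assms by real_asymp
  show "(\<lambda>n. (real n * t) * ln (real n * t) / (real n * t * ln (real n))) \<longlonglongrightarrow> 1"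
    using assms by real_asymp
  have big: "\<forall>\<^sub>F n in sequentially. real n * t - 1 \<ge> 1" using assms by real_asymp
  have n2: "\<forall>\<^sub>F n::nat in sequentially. real n \<ge> 2" by real_asymp
  show "\<forall>\<^sub>F n in sequentially. (real n * t - 1) * ln (real n * t - 1) / (real n * t * ln (real n))
      \<le> ?k n * ln (?k n) / (real n * t * ln (real n))"
    using big n2
  proof eventually_elim
    case (elim n)
    then show ?case using floor_mult_bounds[OF assms, of n] assms
      by (intro divide_right_mono mult_mono ln_mono) auto
  qed
  show "\<forall>\<^sub>F n in sequentially. ?k n * ln (?k n) / (real n * t * ln (real n))
      \<le> (real n * t) * ln (real n * t) / (real n * t * ln (real n))"
    using big n2
  proof eventually_elim
    case (elim n)
    then show ?case using floor_mult_bounds[OF assms, of n] assms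
      by (intro divide_right_mono mult_mono ln_mono) auto
  qed
qed

lemma floor_mult_drift_asymp:
  assumes "0 < t"
  shows "(\<lambda>n. real (nat \<lfloor>real n * t\<rfloor>) * (drift_bound (real (nat \<lfloor>real n * t\<rfloor>)) - ln (real (nat \<lfloor>real n * t\<rfloor>)) + 41)
    / (real n * t * ln (real n))) \<longlonglongrightarrow> 0"
proof -
  let ?k = "\<lambda>n. real (nat \<lfloor>real n * t\<rfloor>)"
  have cancel: "(x * ln x / a) * (d / ln x) = x * d / a" if "1 < x" for x a d :: real
    using that by simp
  have "(\<lambda>n. (?k n * ln (?k n) / (real n * t * ln (real n))) * ((drift_bound (?k n) - ln (?k n) + 41) / ln (?k n)))
      \<longlonglongrightarrow> 1 * 0"
    by (intro tendsto_mult floor_mult_ln_asymp assms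
        filterlim_compose[OF drift_bound_asymp filterlim_floor_mult[OF assms]])
  \<comment> \<open>Cancelling \<open>ln k\<close> is legitimate only once
    \<open>k > 1\<close>.\<close>
  moreover have "\<forall>\<^sub>F n in sequentially.
      (?k n * ln (?k n) / (real n * t * ln (real n))) * ((drift_bound (?k n) - ln (?k n) + 41) / ln (?k n)) =
      ?k n * (drift_bound (?k n) - ln (?k n) + 41) / (real n * t * ln (real n))"
    using filterlim_at_top_dense[THEN iffD1, OF filterlim_floor_mult[OF assms], rule_format, of 1]
    by eventually_elim (rule cancel)
  ultimately show ?thesis by (simp add: tendsto_cong)
qed

section \<open>From the squared width to the diameter\<close>

context constrained_HL
begin

abbreviation diam :: "nat \<Rightarrow> 'a \<Rightarrow> real" where
  "diam k \<omega> \<equiv> diameter (cluster n (\<lambda>j. X j \<omega>) k)"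

lemma diam_measurable [measurable]: "diam k \<in> borel_measurable M"
  by (rule diameter_cluster_measurable[OF n_ge_1 X_measurable])

text \<open>Three errors add up: the random deviation of \<open>W\<^sup>2\<close>, the deterministic
  replacement of \<open>k ln k\<close> by \<open>n t ln n\<close>, and the geometric gap between
  diameter and interval length, which is \<open>O(sqrt t)\<close>.\<close>

lemma diam_deviation:
  assumes k: "1 \<le> k" "real k \<le> real n * t" and n: "2 \<le> n" and t: "0 < t"
  shows "AE \<omega> in M. \<bar>diam k \<omega> / sqrt (t * ln (real n)) - 1\<bar> \<le>
    \<bar>(W k \<omega>)\<^sup>2 - real k * ln (real k)\<bar> / (real n * t * ln (real n)) +
    (\<bar>real k * ln (real k) / (real n * t * ln (real n)) - 1\<bar> + (6 + 4 * exp 2) / sqrt (ln (real n)))"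
  using AE_feasible[of k]
proof eventually_elim
  case (elim \<omega>)
  let ?q = "sqrt (t * ln (real n))" and ?c = "6 + 4 * exp 2 :: real" and ?A = "real n * t * ln (real n)"
  define s where "s = L k \<omega> + R k \<omega>"
  have q: "0 < ?q" "?q\<^sup>2 = t * ln (real n)" and A: "0 < ?A" using n t by auto
  have s: "0 \<le> s" unfolding s_def using ends_add_pos[OF n_ge_1 k(1), of "\<lambda>j. X j \<omega>"] by simp
  have "real k / real n \<le> t" using k(2) n by (simp add: field_simps)
  then have r: "sqrt (real k / real n) \<le> sqrt t" by simp
  have "diam k \<omega> \<le> s + 1 * sqrt (real k / real n)" "s - ?c * sqrt (real k / real n) \<le> diam k \<omega>"
    using diameter_cluster_le[OF n_ge_1 k(1) elim] diameter_cluster_ge[OF n_ge_1 k(1) elim] by (auto simp: s_def)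
  moreover have "1 * sqrt (real k / real n) \<le> ?c * sqrt (real k / real n)"
    using exp_gt_zero[of "2::real"] by (intro mult_right_mono) (auto simp del: exp_gt_zero)
  moreover have "?c * sqrt (real k / real n) \<le> ?c * sqrt t"
    using r by (intro mult_left_mono) auto
  ultimately have "\<bar>diam k \<omega> - s\<bar> \<le> ?c * sqrt t" by linarith
  then have "\<bar>diam k \<omega> - s\<bar> / ?q \<le> ?c * sqrt t / ?q" using q by (intro divide_right_mono) auto
  also have "\<dots> = ?c / sqrt (ln (real n))" using t by (simp add: real_sqrt_mult)
  finally have 1: "\<bar>diam k \<omega> / ?q - s / ?q\<bar> \<le> ?c / sqrt (ln (real n))"
    using q by (simp add: diff_divide_distrib[symmetric] abs_divide)
  have "s\<^sup>2 = (W k \<omega>)\<^sup>2 / real n"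
    using n by (simp add: s_def width_def power_mult_distrib)
  then have "s\<^sup>2 / ?q\<^sup>2 = (W k \<omega>)\<^sup>2 / ?A" unfolding q(2) by (simp add: mult.assoc)
  then have "\<bar>s / ?q - 1\<bar> \<le> \<bar>(W k \<omega>)\<^sup>2 / ?A - 1\<bar>"
    using abs_sqrt_ratio_le[OF s q(1)] by simp
  also have "\<dots> \<le> \<bar>(W k \<omega>)\<^sup>2 / ?A - real k * ln (real k) / ?A\<bar> + \<bar>real k * ln (real k) / ?A - 1\<bar>"
    using abs_triangle_ineq[of "(W k \<omega>)\<^sup>2 / ?A - real k * ln (real k) / ?A" "real k * ln (real k) / ?A - 1"]
    by simp
  also have "\<bar>(W k \<omega>)\<^sup>2 / ?A - real k * ln (real k) / ?A\<bar> = \<bar>(W k \<omega>)\<^sup>2 - real k * ln (real k)\<bar> / ?A"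
    unfolding diff_divide_distrib[symmetric] abs_divide using A by simp
  finally show ?case using 1 by linarith
qed

text \<open>Once the deterministic errors are below \<open>\<epsilon> / 2\<close>, a deviation above
  \<epsilon> needs a random part of at least \<open>\<epsilon> / 2\<close>, whose probability
  Markov's inequality bounds.\<close>

lemma prob_diam_deviation:
  assumes k: "1 \<le> k" "real k \<le> real n * t" and n: "2 \<le> n" and t: "0 < t" and \<epsilon>: "0 < \<epsilon>"
    and small: "\<bar>real k * ln (real k) / (real n * t * ln (real n)) - 1\<bar> + (6 + 4 * exp 2) / sqrt (ln (real n)) \<le> \<epsilon> / 2"
  shows "prob {\<omega> \<in> space M. \<epsilon> < \<bar>diam k \<omega> / sqrt (t * ln (real n)) - 1\<bar>} \<le>
    2 / \<epsilon> * (real k * (drift_bound (real k) - ln (real k) + 41) / (real n * t * ln (real n)))"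
proof -
  let ?A = "real n * t * ln (real n)"
  let ?V = "\<lambda>\<omega>. \<bar>(W k \<omega>)\<^sup>2 - real k * ln (real k)\<bar>"
  have A: "0 < ?A" using n t by auto
  have c: "0 < ?A * (\<epsilon> / 2)" using A \<epsilon> by simp
  have iV: "integrable M ?V" by (rule integrable_W) (intro continuous_intros)
  have "prob {\<omega> \<in> space M. \<epsilon> < \<bar>diam k \<omega> / sqrt (t * ln (real n)) - 1\<bar>} \<le> prob {\<omega> \<in> space M. ?A * (\<epsilon> / 2) \<le> ?V \<omega>}"
  proof (rule finite_measure_mono_AE)
    show "AE \<omega> in M. \<omega> \<in> {\<omega> \<in> space M. \<epsilon> < \<bar>diam k \<omega> / sqrt (t * ln (real n)) - 1\<bar>} \<longrightarrow>
        \<omega> \<in> {\<omega> \<in> space M. ?A * (\<epsilon> / 2) \<le> ?V \<omega>}"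
      using diam_deviation[OF k n t]
    proof eventually_elim
      case (elim \<omega>)
      have "?A * (\<epsilon> / 2) \<le> ?V \<omega>" if "\<epsilon> < \<bar>diam k \<omega> / sqrt (t * ln (real n)) - 1\<bar>"
      proof -
        have "\<epsilon> / 2 \<le> ?V \<omega> / ?A" using that elim small by linarith
        then show ?thesis using A by (simp add: pos_le_divide_eq mult.commute)
      qed
      then show ?case by simp
    qed
  qed measurable
  also have "\<dots> \<le> expectation ?V / (?A * (\<epsilon> / 2))"
    by (rule integral_Markov_inequality_measure[OF iV, of "{}"]) (use c in auto)
  also have "\<dots> \<le> (real k * (drift_bound (real k) - ln (real k) + 41)) / (?A * (\<epsilon> / 2))"
    using c by (intro divide_right_mono expectation_W_square_deviation k) auto
  finally show ?thesis by (simp add: mult_ac)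
qed

end

theorem theorem1p2:
  fixes M :: "nat \<Rightarrow> 'a measure" and X :: "nat \<Rightarrow> nat \<Rightarrow> 'a \<Rightarrow> real" and t :: real
  assumes "\<And>n. 1 \<le> n \<Longrightarrow> constrained_HL (M n) n (X n)"
    and "0 < t"
  shows "tendsto_in_probability M
      (\<lambda>n \<omega>. diameter (cluster n (\<lambda>j. X n j \<omega>) (nat \<lfloor>real n * t\<rfloor>)) / sqrt (t * ln (real n))) 1
    \<and> (\<forall>n\<ge>1. 1 \<le> real n * t \<longrightarrow>
        (AE \<omega> in M n. \<exists>z \<in> cluster n (\<lambda>j. X n j \<omega>) (nat \<lfloor>real n * t\<rfloor>).
          (\<forall>w \<in> cluster n (\<lambda>j. X n j \<omega>) (nat \<lfloor>real n * t\<rfloor>). Im w \<le> Im z) \<and> Im z \<le> sqrt (2 * t)))"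
proof (intro conjI allI impI)
  let ?k = "\<lambda>n. nat \<lfloor>real n * t\<rfloor>"
  let ?Y = "\<lambda>n \<omega>. diameter (cluster n (\<lambda>j. X n j \<omega>) (?k n)) / sqrt (t * ln (real n))"
  note k_le = floor_mult_bounds[OF assms(2)]
  show "tendsto_in_probability M ?Y 1"
    unfolding tendsto_in_probability_def
  proof (intro conjI allI impI)
    show "\<forall>\<^sub>F n in sequentially. ?Y n \<in> borel_measurable (M n)"
      using eventually_ge_at_top[of 1]
    proof eventually_elim
      case (elim n)
      interpret constrained_HL "M n" n "X n" by (rule assms(1)[OF elim])
      show ?case by measurable
    qed
    fix \<epsilon> :: real assume \<epsilon>: "0 < \<epsilon>"
    let ?A = "\<lambda>n. real n * t * ln (real n)"
    let ?b = "\<lambda>n. 2 / \<epsilon> * (real (?k n) * (drift_bound (real (?k n)) - ln (real (?k n)) + 41) / ?A n)"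
    let ?e = "\<lambda>n. \<bar>real (?k n) * ln (real (?k n)) / ?A n - 1\<bar> + (6 + 4 * exp 2) / sqrt (ln (real n))"
    have "(\<lambda>n. (6 + 4 * exp 2) / sqrt (ln (real n))) \<longlonglongrightarrow> 0" by real_asymp
    moreover have "(\<lambda>n. \<bar>real (?k n) * ln (real (?k n)) / ?A n - 1\<bar>) \<longlonglongrightarrow> \<bar>1 - 1\<bar>"
      by (intro tendsto_intros floor_mult_ln_asymp assms)
    ultimately have "?e \<longlonglongrightarrow> \<bar>1 - 1\<bar> + 0" by (rule tendsto_add[rotated])
    then have small: "\<forall>\<^sub>F n in sequentially. ?e n < \<epsilon> / 2"
      by (rule order_tendstoD) (use \<epsilon> in simp)
    have k1: "\<forall>\<^sub>F n in sequentially. 1 < real (?k n)"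
      using filterlim_at_top_dense[THEN iffD1, OF filterlim_floor_mult[OF assms(2)]] by blast
    show "(\<lambda>n. measure (M n) {\<omega> \<in> space (M n). \<epsilon> < \<bar>?Y n \<omega> - 1\<bar>}) \<longlonglongrightarrow> 0"
    proof (rule tendsto_sandwich[OF _ _ tendsto_const])
      have "?b \<longlonglongrightarrow> 2 / \<epsilon> * 0" by (intro tendsto_mult tendsto_const floor_mult_drift_asymp assms)
      then show "?b \<longlonglongrightarrow> 0" by simp
      show "\<forall>\<^sub>F n in sequentially. measure (M n) {\<omega> \<in> space (M n). \<epsilon> < \<bar>?Y n \<omega> - 1\<bar>} \<le> ?b n"
        using small k1 eventually_ge_at_top[of 2]
      proof eventually_elim
        case (elim n)
        interpret constrained_HL "M n" n "X n" by (rule assms(1)) (use elim in simp)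
        have "1 \<le> ?k n" using elim(2) by linarith
        then show ?case
          by (rule prob_diam_deviation) (use elim k_le[of n] assms(2) \<epsilon> in auto)
      qed
    qed simp
  qed
  fix n :: nat assume n: "1 \<le> n" "1 \<le> real n * t"
  have k: "1 \<le> ?k n" using n(2) by (simp add: le_nat_floor)
  have "real (?k n) / real n \<le> real n * t / real n"
    using k_le(1)[of n] by (intro divide_right_mono) auto
  \<comment> \<open>The quotient equals \<open>t\<close>, so the argument in fact bounds the height
    by \<open>sqrt t\<close>. It does so at every sample point.\<close>
  also have "\<dots> \<le> 2 * t" using n assms(2) by simp
  finally have "sqrt (real (?k n) / real n) \<le> sqrt (2 * t)" by simp
  then show "AE \<omega> in M n. \<exists>z \<in> cluster n (\<lambda>j. X n j \<omega>) (?k n).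
      (\<forall>w \<in> cluster n (\<lambda>j. X n j \<omega>) (?k n). Im w \<le> Im z) \<and> Im z \<le> sqrt (2 * t)"
    using cluster_Im_max[OF n(1) k] by (intro AE_I2) (metis order_trans)
qed

end
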